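(* Let $1\leq p\leq\infty$. The class $\mathcal{D}_p^{\mathcal{H}^\infty}$ of all Cohen strongly $p$-summing holomorphic mappings, with components $\mathcal{D}_p^{\mathcal{H}^\infty}(U,F)$ ($U$ an open subset of a complex Banach space $E$, and $F$ a complex Banach space) equipped with $d_p^{\mathcal{H}^\infty}$, is a regular Banach ideal of bounded holomorphic mappings. Furthermore, for all complex Banach spaces $E,F$ and every open set $U\subseteq E$, one has $\mathcal{D}_1^{\mathcal{H}^\infty}(U,F)=\mathcal{H}^\infty(U,F)$ with $d_1^{\mathcal{H}^\infty}(f)=\|f\|_\infty$ for all $f\in\mathcal{D}_1^{\mathcal{H}^\infty}(U,F)$.
   Context: For $U$ open in a complex Banach space $E$ and $F$ a complex Banach space, $\mathcal{H}(U,F)$ is the space of holomorphic (Fréchet differentiable at every point) mappings from $U$ to $F$; $\mathcal{H}(V,U)$, for $V,U$ open subsets of complex Banach spaces, is the set of holomorphic mappings from $V$ to $U$; $\mathcal{H}^\infty(U,F)$ is the Banach space of all bounded $f\in\mathcal{H}(U,F)$ with $\|f\|_\infty=\sup_{x\in U}\|f(x)\|$; $\mathcal{H}^\infty(U)=\mathcal{H}^\infty(U,\mathbb{C})$. $B_X$ is the closed unit ball of $X$, $\mathcal{L}(F,G)$ is the space of bounded linear operators, $\kappa_F\colon F\to F^{**}$ is the canonical embedding. $p^*$ is the conjugate index of $p$ ($p^*=p/(p-1)$ if $1<p<\infty$, $1^*=\infty$, $\infty^*=1$). Cohen strongly $p$-summing: a holomorphic mapping $f\colon U\to F$ is Cohen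 strongly $p$-summing if there is a constant $C\geq 0$ such that for all $n\in\mathbb{N}$, $\lambda_1,\dots,\lambda_n\in\mathbb{C}$, $x_1,\dots,x_n\in U$, $y_1^*,\dots,y_n^*\in F^*$, $$\sum_{i=1}^n|\lambda_i||\langle y_i^*,f(x_i)\rangle|\leq C\,\|(\lambda_i)_{i=1}^n\|_{\ell_p^n}\,\|(y_i^* )_{i=1}^n\|_{\ell_{p^*}^{n,w}(F^* )},$$ where $\|(\lambda_i)\|_{\ell_p^n}=(\sum_i|\lambda_i|^p)^{1/p}$ ($\max_i|\lambda_i|$ if $p=\infty$) and $\|(y_i^* )\|_{\ell_{p^*}^{n,w}(F^* )}=\sup_{y^{**}\in B_{F^{**}}}(\sum_i|y^{**}(y_i^* )|^{p^*})^{1/p^*}$ (with $\max_i|y^{**}(y_i^* )|$ in place of the sum expression if $p^*=\infty$). $d_p^{\mathcal{H}^\infty}(f)$ is the infimum of such $C$, and $\mathcal{D}_p^{\mathcal{H}^\infty}(U,F)$ is the set of all such $f$. For $g\in\mathcal{H}^\infty(U)$, $y\in F$, let $g\cdot y\colon U\to F$, $(g\cdot y)(x)=g(x)y$. An ideal of bounded holomorphic mappings is a subclass $\mathcal{I}^{\mathcal{H}^\infty}$ of $\mathcal{H}^\infty$ such that for every complex Banach space $E$, open $U\subseteq E$ and complex Banach space $F$, the components $\mathcal{I}^{\mathcal{H}^\infty}(U,F)=\mathcal{I}^{\mathcal{H}^\infty}\cap\mathcal{H}^\infty(U,F)$ satisfy: (I1) $\mathcal{I}^{\mathcal{H}^\infty}(U,F)$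 is a linear subspace of $\mathcal{H}^\infty(U,F)$; (I2) $g\cdot y\in\mathcal{I}^{\mathcal{H}^\infty}(U,F)$ for all $g\in\mathcal{H}^\infty(U)$, $y\in F$; (I3) if $H,G$ are complex Banach spaces, $V\subseteq H$ is open, $h\in\mathcal{H}(V,U)$, $f\in\mathcal{I}^{\mathcal{H}^\infty}(U,F)$ and $S\in\mathcal{L}(F,G)$, then $S\circ f\circ h\in\mathcal{I}^{\mathcal{H}^\infty}(V,G)$. It is normed (Banach) if there is a function $\|\cdot\|_{\mathcal{I}^{\mathcal{H}^\infty}}\colon\mathcal{I}^{\mathcal{H}^\infty}\to[0,\infty)$ such that for all such $E,U,F$: (N1) $(\mathcal{I}^{\mathcal{H}^\infty}(U,F),\|\cdot\|_{\mathcal{I}^{\mathcal{H}^\infty}})$ is a normed (Banach) space with $\|f\|_\infty\leq\|f\|_{\mathcal{I}^{\mathcal{H}^\infty}}$ for all its elements $f$; (N2) $\|g\cdot y\|_{\mathcal{I}^{\mathcal{H}^\infty}}=\|g\|_\infty\|y\|$ for all $g\in\mathcal{H}^\infty(U)$, $y\in F$; (N3) with $H,G,V,h,f,S$ as in (I3), $\|S\circ f\circ h\|_{\mathcal{I}^{\mathcal{H}^\infty}}\leq\|S\|\,\|f\|_{\mathcal{I}^{\mathcal{H}^\infty}}$. A normed ideal is regular if for every $f\in\mathcal{H}^\infty(U,F)$ with $\kappa_F\circ f\in\mathcal{I}^{\mathcal{H}^\infty}(U,F^{**})$ one has $f\in\mathcal{I}^{\mathcal{H}^\infty}(U,F)$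 and $\|f\|_{\mathcal{I}^{\mathcal{H}^\infty}}=\|\kappa_F\circ f\|_{\mathcal{I}^{\mathcal{H}^\infty}}$. *)

theory Defs
  imports "HOL-Analysis.Analysis"
begin

section \<open>Complex normed and Banach spaces\<close>

text \<open>
  HOL-Analysis only provides real normed spaces as type classes. A complex structure is added on
  top of the real one; the topology, the norm and completeness are those of the underlying real
  space.
\<close>

class scaleC =
  fixes scaleC :: "complex \<Rightarrow> 'a \<Rightarrow> 'a" (infixr "*\<^sub>C" 75)

class complex_vector = scaleC + real_vector +
  assumes scaleC_add_right: "a *\<^sub>C (x + y) = a *\<^sub>C x + a *\<^sub>C y"
    and scaleC_add_left: "(a + b) *\<^sub>C x = a *\<^sub>C x + b *\<^sub>C x"
    and scaleC_scaleC: "a *\<^sub>C (b *\<^sub>C x) = (a * b) *\<^sub>C x"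
    and scaleC_one: "1 *\<^sub>C x = x"
    and scaleR_scaleC: "r *\<^sub>R x = complex_of_real r *\<^sub>C x"

class complex_normed_vector = complex_vector + real_normed_vector +
  assumes norm_scaleC: "norm (a *\<^sub>C x) = cmod a * norm x"

class cbanach = complex_normed_vector + complete_space

instance cbanach \<subseteq> banach ..

instantiation complex :: cbanach
begin

definition scaleC_complex :: "complex \<Rightarrow> complex \<Rightarrow> complex"
  where "scaleC_complex a z = a * z"

instance
  by standard
    (simp_all add: scaleC_complex_def algebra_simps scaleR_conv_of_real norm_mult)

end

lemma scaleC_minus_right:
  fixes x :: "'a::complex_vector"
  shows "a *\<^sub>C (- x) = - (a *\<^sub>C x)"
proof -
  have z: "a *\<^sub>C (0::'a) = 0"
    using scaleC_add_right[of a "0::'a" 0] by simp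
  have "a *\<^sub>C x + a *\<^sub>C (- x) = 0"
    using scaleC_add_right[of a x "- x"] z by simp
  then show ?thesis
    by (metis add.inverse_unique)
qed

lemma tendsto_scaleC:
  fixes X :: "nat \<Rightarrow> 'a::complex_normed_vector"
  assumes "X \<longlonglongrightarrow> x"
  shows "(\<lambda>n. a *\<^sub>C X n) \<longlonglongrightarrow> a *\<^sub>C x"
proof -
  have "(\<lambda>n. norm (a *\<^sub>C X n - a *\<^sub>C x)) = (\<lambda>n. cmod a * norm (X n - x))"
    by (metis norm_scaleC scaleC_add_right scaleC_minus_right add_uminus_conv_diff)
  moreover have "(\<lambda>n. cmod a * norm (X n - x)) \<longlonglongrightarrow> cmod a * 0"
    using assms by (intro tendsto_mult tendsto_const) (simp add: LIM_zero tendsto_norm_zero)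
  ultimately have "(\<lambda>n. norm (a *\<^sub>C X n - a *\<^sub>C x)) \<longlonglongrightarrow> 0"
    by simp
  then show ?thesis
    by (rule LIM_zero_cancel[OF tendsto_norm_zero_cancel])
qed


section \<open>Bounded complex-linear operators, dual spaces and the canonical embedding\<close>

typedef (overloaded) ('a, 'b) cblinfun =
  "{T :: 'a::complex_normed_vector \<Rightarrow> 'b::complex_normed_vector.
      bounded_linear T \<and> (\<forall>c x. T (c *\<^sub>C x) = c *\<^sub>C T x)}"
  morphisms cblinfun_apply CBlinfun
proof -
  have "a *\<^sub>C (0::'b) = 0" for a
    using scaleC_add_right[of a "0::'b" 0] by simp
  then show ?thesis
    by (intro exI[of _ "\<lambda>_. 0"]) auto
qed

type_synonym 'a cdual = "('a, complex) cblinfun"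

lemma bounded_linear_cblinfun_apply: "bounded_linear (cblinfun_apply T)"
  using cblinfun_apply[of T] by blast

lemma cblinfun_apply_scaleC: "cblinfun_apply T (c *\<^sub>C x) = c *\<^sub>C cblinfun_apply T x"
  using cblinfun_apply[of T] by blast

lemma cblinfun_eqI: "(\<And>x. cblinfun_apply S x = cblinfun_apply T x) \<Longrightarrow> S = T"
  by (metis cblinfun_apply_inject ext)

lemma CBlinfun_apply:
  assumes "bounded_linear T" "\<And>c x. T (c *\<^sub>C x) = c *\<^sub>C T x"
  shows "cblinfun_apply (CBlinfun T) x = T x"
  using assms by (simp add: CBlinfun_inverse)

instantiation cblinfun :: (complex_normed_vector, complex_normed_vector) complex_normed_vector
begin

definition "zero_cblinfun = CBlinfun (\<lambda>_. 0)"
definition "S + T = CBlinfun (\<lambda>x. cblinfun_apply S x + cblinfun_apply T x)"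
definition "- T = CBlinfun (\<lambda>x. - cblinfun_apply T x)"
definition "S - T = CBlinfun (\<lambda>x. cblinfun_apply S x - cblinfun_apply T x)"
definition "r *\<^sub>R T = CBlinfun (\<lambda>x. r *\<^sub>R cblinfun_apply T x)"
definition "c *\<^sub>C T = CBlinfun (\<lambda>x. c *\<^sub>C cblinfun_apply T x)"
definition "norm T = onorm (cblinfun_apply T)"
definition "dist S T = norm (S - T)" for S T :: "('a, 'b) cblinfun"
definition "sgn T = inverse (norm T) *\<^sub>R T" for T :: "('a, 'b) cblinfun"
definition [code del]:
  "(uniformity :: (('a, 'b) cblinfun \<times> ('a, 'b) cblinfun) filter) =
     (INF e\<in>{0 <..}. principal {(x, y). dist x y < e})"
definition [code del]:
  "open (U :: ('a, 'b) cblinfun set) \<longleftrightarrow>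
     (\<forall>x\<in>U. \<forall>\<^sub>F (x', y) in uniformity. x' = x \<longrightarrow> y \<in> U)"

lemma zero_apply: "cblinfun_apply (0 :: ('a, 'b) cblinfun) x = 0"
  unfolding zero_cblinfun_def
proof (rule CBlinfun_apply)
  show "0 = c *\<^sub>C (0::'b)" for c
    using scaleC_add_right[of c "0::'b" 0] by simp
qed simp

lemma plus_apply:
  "cblinfun_apply (S + T :: ('a, 'b) cblinfun) x = cblinfun_apply S x + cblinfun_apply T x"
  unfolding plus_cblinfun_def
  by (rule CBlinfun_apply)
    (simp_all add: bounded_linear_add bounded_linear_cblinfun_apply cblinfun_apply_scaleC
      scaleC_add_right)

lemma uminus_apply: "cblinfun_apply (- T :: ('a, 'b) cblinfun) x = - cblinfun_apply T x"
  unfolding uminus_cblinfun_def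
  by (rule CBlinfun_apply)
    (simp_all add: bounded_linear_minus bounded_linear_cblinfun_apply cblinfun_apply_scaleC
      scaleC_minus_right)

lemma minus_apply:
  "cblinfun_apply (S - T :: ('a, 'b) cblinfun) x = cblinfun_apply S x - cblinfun_apply T x"
  unfolding minus_cblinfun_def
proof (rule CBlinfun_apply)
  show "bounded_linear (\<lambda>x. cblinfun_apply S x - cblinfun_apply T x)"
    by (intro bounded_linear_sub bounded_linear_cblinfun_apply)
  show "cblinfun_apply S (c *\<^sub>C x) - cblinfun_apply T (c *\<^sub>C x)
      = c *\<^sub>C (cblinfun_apply S x - cblinfun_apply T x)" for c x
    using scaleC_add_right[of c "cblinfun_apply S x" "- cblinfun_apply T x"]
    by (simp add: cblinfun_apply_scaleC scaleC_minus_right)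
qed

lemma scaleR_apply: "cblinfun_apply (r *\<^sub>R T :: ('a, 'b) cblinfun) x = r *\<^sub>R cblinfun_apply T x"
  unfolding scaleR_cblinfun_def
proof (rule CBlinfun_apply)
  show "bounded_linear (\<lambda>x. r *\<^sub>R cblinfun_apply T x)"
    by (intro bounded_linear_const_scaleR bounded_linear_cblinfun_apply)
qed (simp add: cblinfun_apply_scaleC scaleR_scaleC scaleC_scaleC mult.commute)

lemma bounded_linear_scaleC: "bounded_linear ((*\<^sub>C) c :: 'b \<Rightarrow> 'b)"
  by (rule bounded_linear_intro[where K = "cmod c"])
    (simp_all add: scaleC_add_right scaleR_scaleC scaleC_scaleC norm_scaleC mult.commute)

lemma scaleC_apply: "cblinfun_apply (c *\<^sub>C T :: ('a, 'b) cblinfun) x = c *\<^sub>C cblinfun_apply T x"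
  unfolding scaleC_cblinfun_def
  by (rule CBlinfun_apply)
    (simp_all add: bounded_linear_compose[OF bounded_linear_scaleC bounded_linear_cblinfun_apply]
      cblinfun_apply_scaleC scaleC_scaleC mult.commute)

lemmas cblinfun_apply_simps =
  zero_apply plus_apply uminus_apply minus_apply scaleR_apply scaleC_apply

instance
proof
  fix S T V :: "('a, 'b) cblinfun" and r s :: real and a b :: complex
  show "S + T + V = S + (T + V)" "S + T = T + S" "0 + S = S" "- S + S = 0" "S - T = S + - T"
    by (auto intro!: cblinfun_eqI simp: cblinfun_apply_simps)
  show "r *\<^sub>R (S + T) = r *\<^sub>R S + r *\<^sub>R T" "(r + s) *\<^sub>R T = r *\<^sub>R T + s *\<^sub>R T"
    "r *\<^sub>R s *\<^sub>R T = (r * s) *\<^sub>R T" "1 *\<^sub>R T = T"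
    by (auto intro!: cblinfun_eqI simp: cblinfun_apply_simps scaleR_add_left scaleR_add_right)
  show "a *\<^sub>C (S + T) = a *\<^sub>C S + a *\<^sub>C T" "(a + b) *\<^sub>C T = a *\<^sub>C T + b *\<^sub>C T"
    "a *\<^sub>C b *\<^sub>C T = (a * b) *\<^sub>C T" "1 *\<^sub>C T = T" "r *\<^sub>R T = complex_of_real r *\<^sub>C T"
    by (auto intro!: cblinfun_eqI
        simp: cblinfun_apply_simps scaleC_add_left scaleC_add_right scaleC_scaleC scaleC_one
          scaleR_scaleC)
  show "dist S T = norm (S - T)" by (rule dist_cblinfun_def)
  show "sgn T = inverse (norm T) *\<^sub>R T" by (rule sgn_cblinfun_def)
  show "(uniformity :: (('a, 'b) cblinfun \<times> ('a, 'b) cblinfun) filter) =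
     (INF e\<in>{0 <..}. principal {(x, y). dist x y < e})"
    by (rule uniformity_cblinfun_def)
  show "open U \<longleftrightarrow> (\<forall>x\<in>U. \<forall>\<^sub>F (x', y) in uniformity. x' = x \<longrightarrow> y \<in> U)"
    for U :: "('a, 'b) cblinfun set"
    by (rule open_cblinfun_def)
  show "norm T = 0 \<longleftrightarrow> T = 0"
    unfolding norm_cblinfun_def onorm_eq_0[OF bounded_linear_cblinfun_apply]
    by (auto intro!: cblinfun_eqI simp: zero_apply)
  show "norm (S + T) \<le> norm S + norm T"
    unfolding norm_cblinfun_def plus_apply[abs_def]
    by (rule onorm_triangle[OF bounded_linear_cblinfun_apply bounded_linear_cblinfun_apply])
  show "norm (r *\<^sub>R T) = \<bar>r\<bar> * norm T"
    unfolding norm_cblinfun_def scaleR_apply[abs_def]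
    by (rule onorm_scaleR[OF bounded_linear_cblinfun_apply])
  show "norm (a *\<^sub>C T) = cmod a * norm T"
  proof -
    have "(\<lambda>x. norm (a *\<^sub>C cblinfun_apply T x)) = (\<lambda>x. norm (cmod a *\<^sub>R cblinfun_apply T x))"
      by (simp add: norm_scaleC)
    then have "onorm (\<lambda>x. a *\<^sub>C cblinfun_apply T x) = onorm (\<lambda>x. cmod a *\<^sub>R cblinfun_apply T x)"
      unfolding onorm_def by metis
    then show ?thesis
      unfolding norm_cblinfun_def scaleC_apply[abs_def]
      using onorm_scaleR[OF bounded_linear_cblinfun_apply, of "cmod a" T] by simp
  qed
qed

end

lemma norm_cblinfun_apply_le: "norm (cblinfun_apply T x) \<le> norm T * norm x"
  unfolding norm_cblinfun_def by (rule onorm[OF bounded_linear_cblinfun_apply])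

instance cblinfun :: (complex_normed_vector, cbanach) cbanach
proof
  fix X :: "nat \<Rightarrow> ('a, 'b) cblinfun"
  assume "Cauchy X"
  define Y where "Y n = Blinfun (cblinfun_apply (X n))" for n
  have Y: "blinfun_apply (Y n) = cblinfun_apply (X n)" for n
    unfolding Y_def by (simp add: bounded_linear_Blinfun_apply bounded_linear_cblinfun_apply)
  have dist_eq: "norm (Y m - Y n) = norm (X m - X n)" for m n
    unfolding norm_blinfun.rep_eq norm_cblinfun_def
    by (simp add: blinfun.diff_left[abs_def] minus_blinfun.rep_eq minus_apply[abs_def] Y)
  from \<open>Cauchy X\<close> have "Cauchy Y"
    unfolding Cauchy_def dist_norm dist_eq .
  then obtain L where L: "Y \<longlonglongrightarrow> L"
    by (auto simp: Cauchy_convergent_iff convergent_def)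
  have lim: "(\<lambda>n. cblinfun_apply (X n) x) \<longlonglongrightarrow> blinfun_apply L x" for x
    using bounded_linear.tendsto[OF blinfun.bounded_linear_left L, of x] by (simp add: Y)
  have hom: "blinfun_apply L (c *\<^sub>C x) = c *\<^sub>C blinfun_apply L x" for c x
    using LIMSEQ_unique[OF lim[of "c *\<^sub>C x"]] tendsto_scaleC[OF lim[of x], of c]
    by (simp add: cblinfun_apply_scaleC)
  define K where "K = CBlinfun (blinfun_apply L)"
  have K: "cblinfun_apply K x = blinfun_apply L x" for x
    unfolding K_def by (rule CBlinfun_apply) (auto simp: hom blinfun.bounded_linear_right)
  have "norm (X n - K) = norm (Y n - L)" for n
    unfolding norm_blinfun.rep_eq norm_cblinfun_def
    by (simp add: minus_blinfun.rep_eq minus_apply[abs_def] Y K)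
  then have "X \<longlonglongrightarrow> K"
    using L by (simp add: LIMSEQ_iff)
  then show "convergent X"
    by (auto simp: convergent_def)
qed

definition eval_dual :: "'f::complex_normed_vector \<Rightarrow> 'f cdual cdual"
  where "eval_dual y = CBlinfun (\<lambda>\<phi>. cblinfun_apply \<phi> y)"

lemma eval_dual_apply: "cblinfun_apply (eval_dual y) \<phi> = cblinfun_apply \<phi> y"
  unfolding eval_dual_def
proof (rule CBlinfun_apply)
  show "bounded_linear (\<lambda>\<phi>::'a cdual. cblinfun_apply \<phi> y)"
    by (rule bounded_linear_intro[where K = "norm y"])
      (simp_all add: plus_apply scaleR_apply norm_cblinfun_apply_le)
qed (simp add: scaleC_apply)

definition canonical_embedding :: "('f::complex_normed_vector, 'f cdual cdual) cblinfun"
  where "canonical_embedding = CBlinfun eval_dual"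

lemma canonical_embedding_apply:
  "cblinfun_apply (cblinfun_apply canonical_embedding y) \<phi> = cblinfun_apply \<phi> y"
proof -
  have "bounded_linear (eval_dual :: 'a \<Rightarrow> 'a cdual cdual)"
  proof (rule bounded_linear_intro[where K = 1])
    show "eval_dual (x + y) = eval_dual x + eval_dual y" for x y :: 'a
      by (rule cblinfun_eqI)
        (simp add: plus_apply eval_dual_apply bounded_linear.linear[THEN linear_add]
          bounded_linear_cblinfun_apply)
    show "eval_dual (r *\<^sub>R x) = r *\<^sub>R eval_dual x" for r and x :: 'a
      by (rule cblinfun_eqI)
        (simp only: scaleR_scaleC scaleC_apply eval_dual_apply cblinfun_apply_scaleC)
    show "norm (eval_dual x) \<le> norm x * 1" for x :: 'a
      unfolding norm_cblinfun_def[of "eval_dual x"]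
      by (rule onorm_bound)
        (auto simp: eval_dual_apply mult.commute[of "norm x"] norm_cblinfun_apply_le)
  qed
  moreover have "eval_dual (c *\<^sub>C x) = c *\<^sub>C eval_dual x" for c and x :: 'a
    by (rule cblinfun_eqI) (simp only: scaleC_apply eval_dual_apply cblinfun_apply_scaleC)
  ultimately have "cblinfun_apply canonical_embedding y = eval_dual y"
    unfolding canonical_embedding_def by (rule CBlinfun_apply)
  then show ?thesis
    by (simp add: eval_dual_apply)
qed


section \<open>Holomorphic mappings\<close>

text \<open>
  A mapping with domain \<open>U \<subseteq> E\<close> is represented by the total function that extends it by \<open>0\<close>
  outside \<open>U\<close>; this makes the representation unique, so that equality of mappings on \<open>U\<close> is
  equality of functions. \<open>zero_ext U f\<close> is the representative of the restriction of \<open>f\<close> to \<open>U\<close>.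
\<close>

definition zero_ext :: "'e set \<Rightarrow> ('e \<Rightarrow> 'f::zero) \<Rightarrow> 'e \<Rightarrow> 'f"
  where "zero_ext U f = (\<lambda>x. if x \<in> U then f x else 0)"

definition Hol :: "'e::cbanach set \<Rightarrow> ('e \<Rightarrow> 'f::cbanach) set"
  where "Hol U = {f. (\<forall>x\<in>U. \<exists>D :: ('e, 'f) cblinfun. (f has_derivative cblinfun_apply D) (at x))
                   \<and> (\<forall>x. x \<notin> U \<longrightarrow> f x = 0)}"

definition Hol_into :: "'h::cbanach set \<Rightarrow> 'e::cbanach set \<Rightarrow> ('h \<Rightarrow> 'e) set"
  where "Hol_into V U = {h \<in> Hol V. h ` V \<subseteq> U}"

definition Hinf :: "'e::cbanach set \<Rightarrow> ('e \<Rightarrow> 'f::cbanach) set"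
  where "Hinf U = {f \<in> Hol U. bounded (f ` U)}"

text \<open>The element \<open>0\<close> is inserted only to give the supremum over \<open>U = {}\<close> the value \<open>0\<close>.\<close>

definition sup_norm :: "'e::cbanach set \<Rightarrow> ('e \<Rightarrow> 'f::cbanach) \<Rightarrow> real"
  where "sup_norm U f = Sup (insert 0 ((\<lambda>x. norm (f x)) ` U))"


section \<open>Cohen strongly p-summing mappings\<close>

definition conj_index :: "ennreal \<Rightarrow> ennreal"
  where "conj_index p = (if p = 1 then \<infinity> else if p = \<infinity> then 1 else p / (p - 1))"

text \<open>Finite sequences of length \<open>n \<ge> 1\<close> are indexed by \<open>{..<n}\<close>.\<close>

definition lp_norm :: "ennreal \<Rightarrow> nat \<Rightarrow> (nat \<Rightarrow> complex) \<Rightarrow> real"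
  where "lp_norm p n a =
    (if p = \<infinity> then Max ((\<lambda>i. cmod (a i)) ` {..<n})
     else (\<Sum>i<n. cmod (a i) powr enn2real p) powr (1 / enn2real p))"

definition weak_lp_norm_dual :: "ennreal \<Rightarrow> nat \<Rightarrow> (nat \<Rightarrow> 'f::cbanach cdual) \<Rightarrow> real"
  where "weak_lp_norm_dual q n ys =
    (SUP \<Phi>\<in>cball (0 :: 'f cdual cdual) 1. lp_norm q n (\<lambda>i. cblinfun_apply \<Phi> (ys i)))"

definition cohen_bound ::
  "ennreal \<Rightarrow> 'e::cbanach set \<Rightarrow> ('e \<Rightarrow> 'f::cbanach) \<Rightarrow> real \<Rightarrow> bool"
  where "cohen_bound p U f C \<longleftrightarrow>
    0 \<le> C \<and>
    (\<forall>n\<ge>1. \<forall>(ls :: nat \<Rightarrow> complex) (xs :: nat \<Rightarrow> 'e) (ys :: nat \<Rightarrow> 'f cdual).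
       (\<forall>i<n. xs i \<in> U) \<longrightarrow>
       (\<Sum>i<n. cmod (ls i) * cmod (cblinfun_apply (ys i) (f (xs i))))
         \<le> C * lp_norm p n ls * weak_lp_norm_dual (conj_index p) n ys)"

definition cohen_summing :: "ennreal \<Rightarrow> 'e::cbanach set \<Rightarrow> ('e \<Rightarrow> 'f::cbanach) set"
  where "cohen_summing p U = {f \<in> Hol U. \<exists>C. cohen_bound p U f C}"

definition cohen_norm :: "ennreal \<Rightarrow> 'e::cbanach set \<Rightarrow> ('e \<Rightarrow> 'f::cbanach) \<Rightarrow> real"
  where "cohen_norm p U f = Inf {C. cohen_bound p U f C}"


section \<open>Normed and Banach spaces of functions\<close>

definition function_subspace :: "('a \<Rightarrow> 'b::complex_vector) set \<Rightarrow> bool"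
  where "function_subspace A \<longleftrightarrow>
    (\<lambda>_. 0) \<in> A \<and>
    (\<forall>f\<in>A. \<forall>g\<in>A. (\<lambda>x. f x + g x) \<in> A) \<and>
    (\<forall>c. \<forall>f\<in>A. (\<lambda>x. c *\<^sub>C f x) \<in> A)"

definition normed_function_space ::
  "('a \<Rightarrow> 'b::complex_vector) set \<Rightarrow> (('a \<Rightarrow> 'b) \<Rightarrow> real) \<Rightarrow> bool"
  where "normed_function_space A N \<longleftrightarrow>
    function_subspace A \<and>
    (\<forall>f\<in>A. 0 \<le> N f) \<and>
    (\<forall>f\<in>A. N f = 0 \<longleftrightarrow> f = (\<lambda>_. 0)) \<and>
    (\<forall>c. \<forall>f\<in>A. N (\<lambda>x. c *\<^sub>C f x) = cmod c * N f) \<and>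
    (\<forall>f\<in>A. \<forall>g\<in>A. N (\<lambda>x. f x + g x) \<le> N f + N g)"

definition banach_function_space ::
  "('a \<Rightarrow> 'b::complex_vector) set \<Rightarrow> (('a \<Rightarrow> 'b) \<Rightarrow> real) \<Rightarrow> bool"
  where "banach_function_space A N \<longleftrightarrow>
    normed_function_space A N \<and>
    (\<forall>X :: nat \<Rightarrow> 'a \<Rightarrow> 'b.
       (\<forall>n. X n \<in> A) \<longrightarrow>
       (\<forall>e>0. \<exists>M. \<forall>m\<ge>M. \<forall>n\<ge>M. N (\<lambda>x. X m x - X n x) < e) \<longrightarrow>
       (\<exists>f\<in>A. (\<lambda>n. N (\<lambda>x. X n x - f x)) \<longlonglongrightarrow> 0))"


section \<open>Ideals of bounded holomorphic mappings\<close>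

text \<open>
  HOL cannot quantify over types inside a formula, so an ideal, whose components range over all
  complex Banach spaces, is described componentwise. A component \<open>I\<close> sends an open \<open>U \<subseteq> E\<close> to the
  set of mappings from \<open>U\<close> to \<open>F\<close> in the ideal, and \<open>N U f\<close> is the ideal norm of \<open>f\<close> in the
  component over \<open>U\<close>. The quantification over the spaces \<open>E\<close>, \<open>F\<close>, \<open>H\<close>, \<open>G\<close> is the implicit one
  over the type variables \<open>'e\<close>, \<open>'f\<close>, \<open>'h\<close>, \<open>'g\<close> of a theorem whose ideal is given by constants
  polymorphic in them.
\<close>

definition holo_ideal_component :: "('e::cbanach set \<Rightarrow> ('e \<Rightarrow> 'f::cbanach) set) \<Rightarrow> bool"
  where "holo_ideal_component I \<longleftrightarrow>
    (\<forall>U. open U \<longrightarrow>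
       I U \<subseteq> Hinf U \<and>
       function_subspace (I U) \<and>
       (\<forall>g\<in>Hinf U. \<forall>y. (\<lambda>x. g x *\<^sub>C y) \<in> I U))"

definition holo_ideal_composition ::
  "('e::cbanach set \<Rightarrow> ('e \<Rightarrow> 'f::cbanach) set) \<Rightarrow>
   ('h::cbanach set \<Rightarrow> ('h \<Rightarrow> 'g::cbanach) set) \<Rightarrow> bool"
  where "holo_ideal_composition I J \<longleftrightarrow>
    (\<forall>U V. open U \<longrightarrow> open V \<longrightarrow>
       (\<forall>h\<in>Hol_into V U. \<forall>f\<in>I U. \<forall>S :: ('f, 'g) cblinfun.
          zero_ext V (cblinfun_apply S \<circ> f \<circ> h) \<in> J V))"

definition banach_ideal_component ::
  "('e::cbanach set \<Rightarrow> ('e \<Rightarrow> 'f::cbanach) set) \<Rightarrow> ('e set \<Rightarrow> ('e \<Rightarrow> 'f) \<Rightarrow> real) \<Rightarrow> bool"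
  where "banach_ideal_component I N \<longleftrightarrow>
    (\<forall>U. open U \<longrightarrow>
       banach_function_space (I U) (N U) \<and>
       (\<forall>f\<in>I U. sup_norm U f \<le> N U f) \<and>
       (\<forall>g\<in>Hinf U. \<forall>y. N U (\<lambda>x. g x *\<^sub>C y) = sup_norm U g * norm y))"

definition normed_ideal_composition ::
  "('e::cbanach set \<Rightarrow> ('e \<Rightarrow> 'f::cbanach) set) \<Rightarrow> ('e set \<Rightarrow> ('e \<Rightarrow> 'f) \<Rightarrow> real) \<Rightarrow>
   ('h::cbanach set \<Rightarrow> ('h \<Rightarrow> 'g::cbanach) \<Rightarrow> real) \<Rightarrow> bool"
  where "normed_ideal_composition I N M \<longleftrightarrow>
    (\<forall>U V. open U \<longrightarrow> open V \<longrightarrow>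
       (\<forall>h\<in>Hol_into V U. \<forall>f\<in>I U. \<forall>S :: ('f, 'g) cblinfun.
          M V (zero_ext V (cblinfun_apply S \<circ> f \<circ> h)) \<le> norm S * N U f))"

definition regular_ideal_component ::
  "('e::cbanach set \<Rightarrow> ('e \<Rightarrow> 'f::cbanach) set) \<Rightarrow> ('e set \<Rightarrow> ('e \<Rightarrow> 'f) \<Rightarrow> real) \<Rightarrow>
   ('e set \<Rightarrow> ('e \<Rightarrow> 'f cdual cdual) set) \<Rightarrow> ('e set \<Rightarrow> ('e \<Rightarrow> 'f cdual cdual) \<Rightarrow> real) \<Rightarrow> bool"
  where "regular_ideal_component I N I'' N'' \<longleftrightarrow>
    (\<forall>U. open U \<longrightarrow>
       (\<forall>f\<in>Hinf U. cblinfun_apply canonical_embedding \<circ> f \<in> I'' U \<longrightarrow>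
          f \<in> I U \<and> N U f = N'' U (cblinfun_apply canonical_embedding \<circ> f)))"

text \<open>
  The arguments are the components for \<open>(E, F)\<close>, for the target \<open>(H, G)\<close> of the compositions
  \<open>S \<circ> f \<circ> h\<close>, and for \<open>(E, F\<^sup>*\<^sup>*)\<close>, each with its norm.
\<close>

definition regular_banach_holo_ideal ::
  "('e::cbanach set \<Rightarrow> ('e \<Rightarrow> 'f::cbanach) set) \<Rightarrow> ('e set \<Rightarrow> ('e \<Rightarrow> 'f) \<Rightarrow> real) \<Rightarrow>
   ('h::cbanach set \<Rightarrow> ('h \<Rightarrow> 'g::cbanach) set) \<Rightarrow> ('h set \<Rightarrow> ('h \<Rightarrow> 'g) \<Rightarrow> real) \<Rightarrow>
   ('e set \<Rightarrow> ('e \<Rightarrow> 'f cdual cdual) set) \<Rightarrow> ('e set \<Rightarrow> ('e \<Rightarrow> 'f cdual cdual) \<Rightarrow> real) \<Rightarrow> bool"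
  where "regular_banach_holo_ideal I N J M I'' N'' \<longleftrightarrow>
    holo_ideal_component I \<and> holo_ideal_composition I J \<and>
    banach_ideal_component I N \<and> normed_ideal_composition I N M \<and>
    regular_ideal_component I N I'' N''"

end

theory Submission
  imports Defs "HOL-Complex_Analysis.Cauchy_Integral_Formula"
begin

text \<open>
  Call \<open>C\<close> a constant of \<open>f\<close> if it satisfies the inequality that defines Cohen strongly \<open>p\<close>-summing
  mappings (\<open>cohen_bound\<close>). The infimum of the constants is attained
  (\<open>cohen_bound_cohen_norm\<close>), so every statement about the norm reduces to one about constants.
  Sums and scalar multiples are clear from the triangle inequality. For \<open>S \<circ> f \<circ> h\<close> the functionals
  are moved to \<open>F\<close> by the adjoint of \<open>S\<close>, which multiplies weak norms by at most \<open>norm S\<close>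
  (\<open>cohen_bound_compose\<close>). For \<open>g \<cdot> y\<close> the constant comes from Hoelder's inequality
  (\<open>cohen_bound_scaleC_const\<close>). Regularity is the same argument as for compositions, with
  the adjoint replaced by the canonical embedding of \<open>F\<^sup>*\<close> (\<open>cohen_bound_of_bidual\<close>).

  Two facts from analysis enter. The Hahn-Banach theorem, in the form that every vector \<open>y\<close> has
  a functional of norm at most \<open>1\<close> with value of modulus \<open>norm y\<close> (\<open>norming_functional_exists\<close>), shows
  that any constant dominates the supremum norm (\<open>norm_le_cohen_bound\<close>). Over
  the reals such a functional is a minimal sublinear functional below a modification of the norm
  that forces the value at \<open>y\<close> (\<open>sublinear_tilt\<close>, \<open>linear_below_sublinear_exists\<close>). Secondly, completeness
  needs that a uniform limit of holomorphic mappings is holomorphic (\<open>Hol_uniform_limit\<close>). This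
  follows from a Cauchy estimate for the derivative, which is the classical estimate on complex
  lines followed by a norming functional. With the limit at hand, constants pass to it
  pointwise (\<open>cohen_bound_limit\<close>).

  For \<open>p = 1\<close> the conjugate index is \<open>\<infinity>\<close> and the weak norm is the largest norm of the functionals,
  so that \<open>sup_norm U f\<close> is itself a constant (\<open>cohen_bound_1\<close>).
\<close>


section \<open>Norming functionals\<close>

definition sublinear :: "('a::real_vector \<Rightarrow> real) \<Rightarrow> bool"
  where "sublinear q \<longleftrightarrow>
    (\<forall>x y. q (x + y) \<le> q x + q y) \<and> (\<forall>t\<ge>0. \<forall>x. q (t *\<^sub>R x) = t * q x)"

lemma sublinearI:
  assumes add: "\<And>x y. q (x + y) \<le> q x + q y"
    and zero: "q 0 = 0"
    and scale: "\<And>t x. 0 < t \<Longrightarrow> q (t *\<^sub>R x) \<le> t * q x"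
  shows "sublinear q"
  unfolding sublinear_def
proof (intro conjI allI impI)
  fix t :: real and x
  assume "0 \<le> t"
  show "q (t *\<^sub>R x) = t * q x"
  proof (cases "t = 0")
    case False
    with \<open>0 \<le> t\<close> have t: "0 < t" by simp
    have "q ((1 / t) *\<^sub>R t *\<^sub>R x) \<le> (1 / t) * q (t *\<^sub>R x)"
      by (rule scale) (use t in simp)
    then have "t * q x \<le> q (t *\<^sub>R x)"
      using t by (simp add: field_simps)
    with scale[OF t, of x] show ?thesis by simp
  qed (simp add: zero)
qed (rule add)

lemma sublinear_add: "sublinear q \<Longrightarrow> q (x + y) \<le> q x + q y"
  and sublinear_scale: "sublinear q \<Longrightarrow> 0 \<le> t \<Longrightarrow> q (t *\<^sub>R x) = t * q x"
  by (auto simp: sublinear_def)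

lemma sublinear_zero: "sublinear q \<Longrightarrow> q 0 = 0"
  using sublinear_scale[of q 0 0] by simp

lemma sublinear_lower: "sublinear q \<Longrightarrow> - q (- x) \<le> q x"
  using sublinear_add[of q x "- x"] sublinear_zero[of q] by simp

lemma sublinear_norm: "sublinear (norm :: 'a::real_normed_vector \<Rightarrow> real)"
  by (simp add: sublinear_def norm_triangle_ineq)

text \<open>
  The infimum \<open>q'(x) = inf {q(x + t a) - t q(a) | t \<ge> 0}\<close> is again sublinear, because the parameters
  of two near-optimal terms can be added. Taking \<open>t = 0\<close> and \<open>t = 1\<close> gives the two upper bounds. The
  bound at \<open>x = - a\<close> is \<open>q'(- a) \<le> - q(a)\<close>, so a linear functional below \<open>q'\<close> is at least \<open>q(a)\<close>
  at \<open>a\<close>.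
\<close>

lemma sublinear_tilt:
  assumes q: "sublinear q"
  obtains q' where "sublinear q'" "\<And>x. q' x \<le> q x" "\<And>x. q' x \<le> q (x + a) - q a"
proof
  define h where "h x t = q (x + t *\<^sub>R a) - t * q a" for x t
  define q' where "q' x = (INF t\<in>{0..}. h x t)" for x
  have bdd: "bdd_below (h x ` {0..})" for x
  proof (rule bdd_belowI2)
    fix t :: real assume "t \<in> {0..}"
    then have "t * q a = q ((x + t *\<^sub>R a) + - x)"
      using sublinear_scale[OF q, of t a] by simp
    also have "\<dots> \<le> q (x + t *\<^sub>R a) + q (- x)"
      by (rule sublinear_add[OF q])
    finally show "- q (- x) \<le> h x t"
      by (simp add: h_def)
  qed
  have le: "q' x \<le> h x t" if "0 \<le> t" for x t
    unfolding q'_def by (rule cINF_lower[OF bdd]) (use that in simp)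
  have ge: "c \<le> q' x" if "\<And>t. 0 \<le> t \<Longrightarrow> c \<le> h x t" for x c
    unfolding q'_def by (rule cINF_greatest) (use that in auto)
  show "sublinear q'"
  proof (rule sublinearI)
    fix x y
    have *: "q' (x + y) \<le> h x s + h y t" if "0 \<le> s" "0 \<le> t" for s t
    proof -
      have "q' (x + y) \<le> h (x + y) (s + t)"
        by (rule le) (use that in simp)
      also have "\<dots> \<le> h x s + h y t"
        using sublinear_add[OF q, of "x + s *\<^sub>R a" "y + t *\<^sub>R a"]
        by (simp add: h_def algebra_simps)
      finally show ?thesis .
    qed
    have "q' (x + y) - h y t \<le> q' x" if "0 \<le> t" for t
      by (rule ge) (use *[OF _ that] in \<open>simp add: algebra_simps\<close>)
    then have "q' (x + y) - q' x \<le> q' y"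
      by (intro ge) (simp add: algebra_simps)
    then show "q' (x + y) \<le> q' x + q' y" by simp
  next
    have "h 0 t = 0" if "0 \<le> t" for t
      using that sublinear_scale[OF q] by (simp add: h_def)
    then show "q' 0 = 0"
      using le[of 0 0] ge[of 0 0] by simp
  next
    fix r :: real and x assume r: "0 < r"
    have "q' (r *\<^sub>R x) / r \<le> h x t" if t: "0 \<le> t" for t
    proof -
      have "q' (r *\<^sub>R x) \<le> h (r *\<^sub>R x) (r * t)"
        by (rule le) (use r t in simp)
      also have "\<dots> = r * h x t"
        using sublinear_scale[OF q, of r "x + t *\<^sub>R a"] r
        by (simp add: h_def algebra_simps)
      finally show ?thesis
        using r by (simp add: field_simps)
    qed
    then have "q' (r *\<^sub>R x) / r \<le> q' x" by (rule ge)
    then show "q' (r *\<^sub>R x) \<le> r * q' x"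
      using r by (simp add: field_simps)
  qed
  show "q' x \<le> q x" for x
    using le[of 0 x] by (simp add: h_def)
  show "q' x \<le> q (x + a) - q a" for x
    using le[of 1 x] by (simp add: h_def)
qed

text \<open>
  Zorn's lemma for the pointwise order. The pointwise infimum of a chain is finite because
  every sublinear \<open>q \<le> p\<close> satisfies \<open>q(x) \<ge> - q(- x) \<ge> - p(- x)\<close>, and subadditivity survives the
  infimum because any two members of a chain have a common lower bound in it.
\<close>

lemma minimal_sublinear_exists:
  fixes p :: "'a::real_vector \<Rightarrow> real"
  assumes p: "sublinear p"
  obtains q where "sublinear q" "\<And>x. q x \<le> p x"
    "\<And>r. sublinear r \<Longrightarrow> (\<And>x. r x \<le> q x) \<Longrightarrow> r = q"
proof -
  define A where "A = {q. sublinear q \<and> (\<forall>x. q x \<le> p x)}"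
  define P :: "('a \<Rightarrow> real) \<Rightarrow> ('a \<Rightarrow> real) \<Rightarrow> bool" where "P q r \<longleftrightarrow> r \<le> q" for q r
  have "\<exists>m\<in>A. \<forall>a\<in>A. P m a \<longrightarrow> a = m"
  proof (rule predicate_Zorn)
    show "partial_order_on A (relation_of P A)"
      by (rule partial_order_on_relation_ofI) (auto simp: P_def)
  next
    fix C assume "C \<in> Chains (relation_of P A)"
    then have CA: "C \<subseteq> A" and tot: "\<And>q r. q \<in> C \<Longrightarrow> r \<in> C \<Longrightarrow> q \<le> r \<or> r \<le> q"
      by (auto simp: Chains_def relation_of_def P_def)
    show "\<exists>u\<in>A. \<forall>q\<in>C. P q u"
    proof (cases "C = {}")
      case True
      have "p \<in> A" using p by (simp add: A_def)
      with True show ?thesis by blast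
    next
      case False
      define u where "u x = (INF q\<in>C. q x)" for x
      have sub: "sublinear q" "q x \<le> p x" if "q \<in> C" for q x
        using CA that by (auto simp: A_def)
      have bdd: "bdd_below ((\<lambda>q. q x) ` C)" for x
      proof (rule bdd_belowI2)
        fix q assume "q \<in> C"
        then show "- p (- x) \<le> q x"
          using sublinear_lower[OF sub(1), of q x] sub(2)[of q "- x"] by linarith
      qed
      have le: "u x \<le> q x" if "q \<in> C" for q x
        unfolding u_def by (rule cINF_lower[OF bdd that])
      have ge: "c \<le> u x" if "\<And>q. q \<in> C \<Longrightarrow> c \<le> q x" for x c
        unfolding u_def by (rule cINF_greatest[OF False that])
      have "sublinear u"
      proof (rule sublinearI)
        fix x y
        have *: "u (x + y) \<le> q x + r y" if qr: "q \<in> C" "r \<in> C" for q r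
        proof -
          from tot[OF qr] obtain s where s: "s \<in> C" "s \<le> q" "s \<le> r"
            using qr by auto
          have "u (x + y) \<le> s (x + y)" by (rule le[OF s(1)])
          also have "\<dots> \<le> s x + s y" by (rule sublinear_add[OF sub(1)[OF s(1)]])
          also have "\<dots> \<le> q x + r y" using s by (intro add_mono) (auto simp: le_fun_def)
          finally show ?thesis .
        qed
        have "u (x + y) - r y \<le> u x" if "r \<in> C" for r
          by (rule ge) (use *[OF _ that] in \<open>simp add: algebra_simps\<close>)
        then have "u (x + y) - u x \<le> u y"
          by (intro ge) (simp add: algebra_simps)
        then show "u (x + y) \<le> u x + u y" by simp
      next
        have "q 0 = 0" if "q \<in> C" for q by (rule sublinear_zero[OF sub(1)[OF that]])
        then show "u 0 = 0" using False le[of _ 0] ge[of 0 0] by fastforce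
      next
        fix t :: real and x assume t: "0 < t"
        have "u (t *\<^sub>R x) / t \<le> q x" if "q \<in> C" for q
          using le[OF that, of "t *\<^sub>R x"] sublinear_scale[OF sub(1)[OF that], of t x] t
          by (simp add: field_simps)
        then have "u (t *\<^sub>R x) / t \<le> u x" by (rule ge)
        then show "u (t *\<^sub>R x) \<le> t * u x"
          using t by (simp add: field_simps)
      qed
      moreover have "u x \<le> p x" for x
        using False le sub(2) by (meson all_not_in_conv order_trans)
      ultimately show ?thesis
        using le by (intro bexI[of _ u]) (auto simp: A_def P_def le_fun_def)
    qed
  qed
  then obtain q where q: "q \<in> A" "\<And>r. r \<in> A \<Longrightarrow> r \<le> q \<Longrightarrow> r = q"
    by (auto simp: P_def)
  show thesis
  proof (rule that)
    show "sublinear q" "\<And>x. q x \<le> p x"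
      using q(1) by (auto simp: A_def)
    show "r = q" if "sublinear r" "\<And>x. r x \<le> q x" for r
      using q(1) that by (intro q(2)) (auto simp: A_def le_fun_def intro: order_trans)
  qed
qed

text \<open>
  A minimal sublinear functional is linear: tilting it cannot make it smaller, and this forces
  \<open>q(x + a) \<ge> q(x) + q(a)\<close>. This is the Hahn-Banach theorem without an extension from a subspace.
\<close>

lemma linear_below_sublinear_exists:
  assumes p: "sublinear p"
  obtains l where "linear l" "\<And>x. l x \<le> p x"
proof -
  obtain q where q: "sublinear q" "\<And>x. q x \<le> p x"
    and min: "\<And>r. sublinear r \<Longrightarrow> (\<And>x. r x \<le> q x) \<Longrightarrow> r = q"
    using minimal_sublinear_exists[OF p] by metis
  have add: "q (x + a) = q x + q a" for x a
  proof -
    obtain q' where "sublinear q'" "\<And>x. q' x \<le> q x" "\<And>x. q' x \<le> q (x + a) - q a"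
      using sublinear_tilt[OF q(1), of a] by metis
    then have "q x \<le> q (x + a) - q a"
      using min[of q'] by metis
    then show ?thesis
      using sublinear_add[OF q(1), of x a] by simp
  qed
  have "q (r *\<^sub>R x) = r * q x" for r x
  proof (cases "0 \<le> r")
    case False
    have "q (r *\<^sub>R x) = - q ((- r) *\<^sub>R x)"
      using add[of "r *\<^sub>R x" "(- r) *\<^sub>R x"] sublinear_zero[OF q(1)] by simp
    also have "\<dots> = r * q x"
      using False sublinear_scale[OF q(1), of "- r" x] by simp
    finally show ?thesis .
  qed (simp add: sublinear_scale[OF q(1)])
  then have "linear q"
    by (intro linearI) (simp_all add: add)
  with q(2) show thesis by (rule that[rotated])
qed

lemma real_norming_functional_exists:
  fixes y :: "'a::real_normed_vector"
  obtains l where "linear l" "\<And>x. l x \<le> norm x" "l y = norm y"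
proof -
  obtain q' where q': "sublinear q'" "\<And>x. q' x \<le> norm x" "\<And>x. q' x \<le> norm (x + y) - norm y"
    using sublinear_tilt[OF sublinear_norm, of y] by metis
  obtain l where l: "linear l" "\<And>x. l x \<le> q' x"
    using linear_below_sublinear_exists[OF q'(1)] by metis
  have "l (- y) \<le> - norm y"
    using l(2)[of "- y"] q'(3)[of "- y"] by simp
  then have "norm y \<le> l y"
    using linear_neg[OF l(1)] by simp
  then show thesis
    using that[of l] l q' by (meson order_trans order_antisym)
qed

lemma norm_cblinfun_leI:
  assumes "0 \<le> b" "\<And>x. norm (cblinfun_apply T x) \<le> b * norm x"
  shows "norm T \<le> b"
  unfolding norm_cblinfun_def by (rule onorm_bound) (use assms in auto)

text \<open>
  The real functional is turned into a complex one by \<open>f(x) = l(x) - \<i> l(\<i> x)\<close>. Its modulus is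
  the value of \<open>l\<close> at a rotation of \<open>x\<close>, hence at most the norm of \<open>x\<close>.
\<close>

lemma norming_functional_exists:
  fixes y :: "'a::complex_normed_vector"
  obtains \<phi> :: "'a cdual" where "norm \<phi> \<le> 1" "cmod (cblinfun_apply \<phi> y) = norm y"
proof -
  obtain l where l: "linear l" "\<And>x. l x \<le> norm x" "l y = norm y"
    using real_norming_functional_exists[of y] by metis
  define f where "f x = Complex (l x) (- l (\<i> *\<^sub>C x))" for x
  have lc: "l (c *\<^sub>C x) = Re c * l x + Im c * l (\<i> *\<^sub>C x)" for c x
  proof -
    have "c *\<^sub>C x = Re c *\<^sub>R x + Im c *\<^sub>R \<i> *\<^sub>C x"
      by (simp add: scaleR_scaleC scaleC_scaleC mult.commute[of _ \<i>]
          flip: scaleC_add_left complex_eq)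
    then show ?thesis
      by (simp add: linear_add[OF l(1)] linear_cmul[OF l(1)])
  qed
  have fC: "f (c *\<^sub>C x) = c * f x" for c x
    by (simp add: f_def complex_eq_iff scaleC_scaleC lc[of c] lc[of "\<i> * c"])
  have fadd: "f (x + x') = f x + f x'" for x x'
    by (simp add: f_def complex_eq_iff linear_add[OF l(1)] scaleC_add_right)
  have fbound: "cmod (f x) \<le> norm x" for x
  proof (cases "f x = 0")
    case False
    \<comment> \<open>the unimodular factor that makes \<open>f (c *\<^sub>C x)\<close> real and nonnegative\<close>
    define c where "c = cnj (f x) / cmod (f x)"
    have c1: "cmod c = 1"
      using False by (simp add: c_def norm_divide)
    have "cnj (f x) * f x = complex_of_real (cmod (f x)) * complex_of_real (cmod (f x))"
      using complex_norm_square[of "f x"] by (simp add: power2_eq_square mult.commute)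
    then have "f (c *\<^sub>C x) = cmod (f x)"
      using False by (simp add: fC c_def)
    then have "cmod (f x) = l (c *\<^sub>C x)"
      by (simp add: f_def complex_eq_iff)
    also have "\<dots> \<le> norm (c *\<^sub>C x)" by (rule l(2))
    finally show ?thesis by (simp add: norm_scaleC c1)
  qed simp
  have "bounded_linear f"
  proof (rule bounded_linear_intro[where K = 1])
    show "f (r *\<^sub>R x) = r *\<^sub>R f x" for r x
      by (simp add: scaleR_scaleC fC scaleR_conv_of_real scaleC_complex_def)
  qed (simp_all add: fadd fbound)
  then have app: "cblinfun_apply (CBlinfun f) x = f x" for x
    by (rule CBlinfun_apply) (simp add: fC scaleC_complex_def)
  show thesis
  proof (rule that)
    show "norm (CBlinfun f) \<le> 1"
      by (rule norm_cblinfun_leI) (simp_all add: app fbound)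
    have "norm y \<le> cmod (f y)"
      using abs_Re_le_cmod[of "f y"] l(3) by (simp add: f_def)
    then show "cmod (cblinfun_apply (CBlinfun f) y) = norm y"
      using fbound[of y] by (simp add: app)
  qed
qed

section \<open>Finite sequence norms and the Hoelder inequality\<close>

text \<open>
  Young's inequality is applied to the sequences after division by their \<open>p\<close>- and \<open>q\<close>-norms, where
  the right-hand sides sum to \<open>1 / p + 1 / q = 1\<close>. If one of the norms vanishes, so does every product.
\<close>

lemma Holder_inequality_sum:
  fixes a b :: "'i \<Rightarrow> real"
  assumes pq: "1 < p" "1 < q" "1 / p + 1 / q = 1" and I: "finite I"
    and a: "\<And>i. i \<in> I \<Longrightarrow> 0 \<le> a i" and b: "\<And>i. i \<in> I \<Longrightarrow> 0 \<le> b i"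
  shows "(\<Sum>i\<in>I. a i * b i) \<le> (\<Sum>i\<in>I. a i powr p) powr (1 / p) * (\<Sum>i\<in>I. b i powr q) powr (1 / q)"
proof -
  define A where "A = (\<Sum>i\<in>I. a i powr p)"
  define B where "B = (\<Sum>i\<in>I. b i powr q)"
  have AB: "0 \<le> A" "0 \<le> B"
    by (auto simp: A_def B_def intro: sum_nonneg)
  show ?thesis
  proof (cases "A = 0 \<or> B = 0")
    case True
    then have "\<forall>i\<in>I. a i * b i = 0"
      using I by (auto simp: A_def B_def sum_nonneg_eq_0_iff)
    then have "(\<Sum>i\<in>I. a i * b i) = 0" by (rule sum.neutral)
    then show ?thesis by simp
  next
    case False
    with AB have pos: "0 < A" "0 < B" by auto
    define \<alpha> where "\<alpha> = A powr (1 / p)"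
    define \<beta> where "\<beta> = B powr (1 / q)"
    have \<alpha>\<beta>: "0 < \<alpha>" "0 < \<beta>" using pos by (simp_all add: \<alpha>_def \<beta>_def)
    have pw: "\<alpha> powr p = A" "\<beta> powr q = B"
      using pos pq by (simp_all add: \<alpha>_def \<beta>_def powr_powr)
    have "(\<Sum>i\<in>I. a i / \<alpha> * (b i / \<beta>)) \<le> (\<Sum>i\<in>I. (a i / \<alpha>) powr p / p + (b i / \<beta>) powr q / q)"
      by (intro sum_mono Youngs_inequality) (use pq a b \<alpha>\<beta> in auto)
    also have "\<dots> = (\<Sum>i\<in>I. a i powr p) / A / p + (\<Sum>i\<in>I. b i powr q) / B / q"
      unfolding sum.distrib sum_divide_distrib
      by (intro arg_cong2[of _ _ _ _ "(+)"] sum.cong refl)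
        (use a b \<alpha>\<beta> pw in \<open>auto simp: powr_divide\<close>)
    also have "\<dots> = 1"
      using pos pq(3) by (simp flip: A_def B_def)
    finally have "(\<Sum>i\<in>I. a i * b i) / (\<alpha> * \<beta>) \<le> 1"
      by (simp add: sum_divide_distrib)
    then show ?thesis
      using \<alpha>\<beta> unfolding \<alpha>_def \<beta>_def A_def B_def by (simp add: field_simps)
  qed
qed

lemma conj_index_cases:
  assumes "1 \<le> p"
  obtains (one) "p = 1" "conj_index p = \<infinity>"
  | (infinity) "p = \<infinity>" "conj_index p = 1"
  | (real) r s where "p = ennreal r" "conj_index p = ennreal s" "1 < r" "1 < s" "1 / r + 1 / s = 1"
proof (cases "p = 1 \<or> p = \<infinity>")
  case True
  then show thesis using one infinity by (auto simp: conj_index_def)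
next
  case False
  then obtain r where r: "p = ennreal r" "0 \<le> r"
    by (cases p) auto
  with False assms have r1: "1 < r"
    by (cases "r = 1") (auto simp: ennreal_le_iff2 simp flip: ennreal_1)
  have "conj_index p = ennreal r / (ennreal r - ennreal 1)"
    using False r by (simp add: conj_index_def)
  also have "\<dots> = ennreal (r / (r - 1))"
    using r1 by (subst ennreal_minus) (simp_all add: divide_ennreal)
  finally show thesis
    using r1 by (intro real[of r "r / (r - 1)"] r(1)) (simp_all add: field_simps)
qed

lemma conj_index_ge_1: "1 \<le> p \<Longrightarrow> 1 \<le> conj_index p"
  by (erule conj_index_cases) (auto simp: ennreal_le_iff2 simp flip: ennreal_1)

lemma exponent_pos: "1 \<le> p \<Longrightarrow> p \<noteq> \<infinity> \<Longrightarrow> 0 < enn2real p"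
  by (cases p) (auto simp: ennreal_le_iff2 simp flip: ennreal_1)

lemma lp_norm_nonneg:
  assumes "1 \<le> n"
  shows "0 \<le> lp_norm p n a"
proof -
  have "cmod (a 0) \<le> Max ((\<lambda>i. cmod (a i)) ` {..<n})"
    using assms by (intro Max_ge) auto
  then have "0 \<le> Max ((\<lambda>i. cmod (a i)) ` {..<n})"
    using norm_ge_zero[of "a 0"] by linarith
  then show ?thesis by (simp add: lp_norm_def)
qed

lemma lp_norm_mono:
  assumes "1 \<le> n" "\<And>i. i < n \<Longrightarrow> cmod (a i) \<le> cmod (b i)"
  shows "lp_norm p n a \<le> lp_norm p n b"
proof (cases "p = \<infinity>")
  case True
  have "Max ((\<lambda>i. cmod (a i)) ` {..<n}) \<le> Max ((\<lambda>i. cmod (b i)) ` {..<n})"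
    using assms by (subst Max_le_iff) (auto simp: lessThan_empty_iff intro!: Max_ge_iff[THEN iffD2])
  with True show ?thesis by (simp add: lp_norm_def)
next
  case False
  then show ?thesis
    using assms unfolding lp_norm_def
    by (auto intro!: powr_mono2 sum_mono sum_nonneg)
qed

lemma lp_norm_mult:
  assumes "1 \<le> p" "1 \<le> n"
  shows "lp_norm p n (\<lambda>i. c * a i) = cmod c * lp_norm p n a"
proof (cases "p = \<infinity>")
  case True
  have "cmod c * Max ((\<lambda>i. cmod (a i)) ` {..<n}) = Max ((*) (cmod c) ` (\<lambda>i. cmod (a i)) ` {..<n})"
    using assms
    by (intro mono_Max_commute) (auto simp: lessThan_empty_iff intro!: monoI mult_left_mono)
  with True show ?thesis by (simp add: lp_norm_def image_image norm_mult)
next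
  case False
  note r = exponent_pos[OF assms(1) False]
  have "(\<Sum>i<n. cmod (c * a i) powr enn2real p) = cmod c powr enn2real p * (\<Sum>i<n. cmod (a i) powr enn2real p)"
    by (simp add: norm_mult powr_mult sum_distrib_left)
  then show ?thesis
    using False r by (simp add: lp_norm_def powr_mult sum_nonneg powr_powr)
qed

lemma lp_norm_single: "1 \<le> p \<Longrightarrow> lp_norm p 1 a = cmod (a 0)"
  using exponent_pos[of p] by (cases "p = \<infinity>") (auto simp: lp_norm_def powr_powr lessThan_Suc)

lemma cmod_le_lp_norm_infinity: "i < n \<Longrightarrow> cmod (a i) \<le> lp_norm \<infinity> n a"
  by (simp add: lp_norm_def)

lemma lp_norm_one: "lp_norm 1 n a = (\<Sum>i<n. cmod (a i))"
  by (simp add: lp_norm_def sum_nonneg)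

lemma lp_norm_Holder:
  assumes "1 \<le> p"
  shows "(\<Sum>i<n. cmod (a i) * cmod (b i)) \<le> lp_norm p n a * lp_norm (conj_index p) n b"
  using assms
proof (cases rule: conj_index_cases)
  case one
  have "(\<Sum>i<n. cmod (a i) * cmod (b i)) \<le> (\<Sum>i<n. cmod (a i) * lp_norm \<infinity> n b)"
    by (intro sum_mono mult_left_mono cmod_le_lp_norm_infinity) auto
  with one show ?thesis by (simp add: lp_norm_one sum_distrib_right)
next
  case infinity
  have "(\<Sum>i<n. cmod (a i) * cmod (b i)) \<le> (\<Sum>i<n. lp_norm \<infinity> n a * cmod (b i))"
    by (intro sum_mono mult_right_mono cmod_le_lp_norm_infinity) auto
  with infinity show ?thesis by (simp add: lp_norm_one sum_distrib_left)
next
  case (real r s)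
  then show ?thesis
    using Holder_inequality_sum[of r s "{..<n}" "\<lambda>i. cmod (a i)" "\<lambda>i. cmod (b i)"]
    by (simp add: lp_norm_def)
qed


section \<open>Composition and adjoint of bounded complex-linear operators\<close>

definition cblinfun_compose ::
  "('b::complex_normed_vector, 'c::complex_normed_vector) cblinfun \<Rightarrow>
   ('a::complex_normed_vector, 'b) cblinfun \<Rightarrow> ('a, 'c) cblinfun"
  where "cblinfun_compose S T = CBlinfun (\<lambda>x. cblinfun_apply S (cblinfun_apply T x))"

lemma cblinfun_compose_apply:
  "cblinfun_apply (cblinfun_compose S T) x = cblinfun_apply S (cblinfun_apply T x)"
  unfolding cblinfun_compose_def
  by (rule CBlinfun_apply)
    (simp_all add: bounded_linear_compose bounded_linear_cblinfun_apply cblinfun_apply_scaleC)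

lemma norm_cblinfun_compose: "norm (cblinfun_compose S T) \<le> norm S * norm T"
proof (rule norm_cblinfun_leI)
  fix x
  have "norm (cblinfun_apply S (cblinfun_apply T x)) \<le> norm S * norm (cblinfun_apply T x)"
    by (rule norm_cblinfun_apply_le)
  also have "\<dots> \<le> norm S * (norm T * norm x)"
    by (intro mult_left_mono norm_cblinfun_apply_le norm_ge_zero)
  finally show "norm (cblinfun_apply (cblinfun_compose S T) x) \<le> norm S * norm T * norm x"
    by (simp add: cblinfun_compose_apply mult.assoc)
qed simp

text \<open>
  The Banach space adjoint \<open>T\<^sup>*\<close>, mapping \<open>G\<^sup>*\<close> to \<open>F\<^sup>*\<close>.
\<close>

definition cblinfun_transpose ::
  "('f::complex_normed_vector, 'g::complex_normed_vector) cblinfun \<Rightarrow> ('g cdual, 'f cdual) cblinfun"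
  where "cblinfun_transpose T = CBlinfun (\<lambda>\<phi>. cblinfun_compose \<phi> T)"

lemma cblinfun_transpose_apply:
  "cblinfun_apply (cblinfun_transpose T) \<phi> = cblinfun_compose \<phi> T"
  unfolding cblinfun_transpose_def
proof (rule CBlinfun_apply)
  show "bounded_linear (\<lambda>\<phi>. cblinfun_compose \<phi> T)"
    by (rule bounded_linear_intro[where K = "norm T"])
      (auto intro!: cblinfun_eqI norm_cblinfun_compose
        simp: cblinfun_compose_apply plus_apply scaleR_apply)
qed (auto intro!: cblinfun_eqI simp: cblinfun_compose_apply scaleC_apply)

lemma norm_cblinfun_transpose: "norm (cblinfun_transpose T) \<le> norm T"
  by (rule norm_cblinfun_leI)
    (use norm_cblinfun_compose[of _ T] in \<open>auto simp: cblinfun_transpose_apply mult.commute\<close>)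

lemma norm_canonical_embedding_apply: "norm (cblinfun_apply canonical_embedding y) \<le> norm y"
  by (rule norm_cblinfun_leI)
    (use norm_cblinfun_apply_le in \<open>auto simp: canonical_embedding_apply mult.commute\<close>)

lemma norm_canonical_embedding:
  "norm (canonical_embedding :: ('f::complex_normed_vector, 'f cdual cdual) cblinfun) \<le> 1"
  by (rule norm_cblinfun_leI) (simp_all add: norm_canonical_embedding_apply)


section \<open>Weak norms of sequences of functionals\<close>

context
  fixes q :: ennreal and n :: nat and ys :: "nat \<Rightarrow> 'f::cbanach cdual"
  assumes q: "1 \<le> q" and n: "1 \<le> n"
begin

text \<open>
  The least upper bound of an unbounded set of reals has no useful value, so the work here is the
  boundedness of the set: on the unit ball of the bidual the sequence is dominated by the norms
  of the \<open>ys i\<close>.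
\<close>

lemma lp_norm_le_weak_unit:
  assumes "norm \<Phi> \<le> 1"
  shows "lp_norm q n (\<lambda>i. cblinfun_apply \<Phi> (ys i)) \<le> weak_lp_norm_dual q n ys"
  unfolding weak_lp_norm_dual_def
proof (rule cSUP_upper)
  show "bdd_above ((\<lambda>\<Phi>. lp_norm q n (\<lambda>i. cblinfun_apply \<Phi> (ys i))) ` cball 0 1)"
  proof (rule bdd_aboveI2)
    fix \<Phi> :: "'f cdual cdual" assume "\<Phi> \<in> cball 0 1"
    then have "cmod (cblinfun_apply \<Phi> (ys i)) \<le> norm (ys i)" for i
      using norm_cblinfun_apply_le[of \<Phi> "ys i"] mult_right_mono[of "norm \<Phi>" 1 "norm (ys i)"]
      by simp
    then show "lp_norm q n (\<lambda>i. cblinfun_apply \<Phi> (ys i)) \<le> lp_norm q n (\<lambda>i. norm (ys i))"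
      by (intro lp_norm_mono[OF n]) simp
  qed
qed (use assms in simp)

lemma weak_lp_norm_nonneg: "0 \<le> weak_lp_norm_dual q n ys"
  by (rule order_trans[OF lp_norm_nonneg[OF n] lp_norm_le_weak_unit[of 0]]) simp

lemma lp_norm_le_weak:
  "lp_norm q n (\<lambda>i. cblinfun_apply \<Phi> (ys i)) \<le> norm \<Phi> * weak_lp_norm_dual q n ys"
proof (cases "\<Phi> = 0")
  case True
  then show ?thesis
    using lp_norm_mult[OF q n, of 0 "\<lambda>_. 0"] by (simp add: zero_apply)
next
  case False
  define \<Psi> where "\<Psi> = (1 / norm \<Phi>) *\<^sub>R \<Phi>"
  have "cblinfun_apply \<Phi> y = complex_of_real (norm \<Phi>) * cblinfun_apply \<Psi> y" for y
    using False by (simp add: \<Psi>_def scaleR_apply scaleR_conv_of_real)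
  then have "lp_norm q n (\<lambda>i. cblinfun_apply \<Phi> (ys i))
      = norm \<Phi> * lp_norm q n (\<lambda>i. cblinfun_apply \<Psi> (ys i))"
    by (simp add: lp_norm_mult[OF q n])
  also have "\<dots> \<le> norm \<Phi> * weak_lp_norm_dual q n ys"
    by (intro mult_left_mono lp_norm_le_weak_unit) (use False in \<open>simp_all add: \<Psi>_def\<close>)
  finally show ?thesis .
qed

lemma weak_lp_norm_least:
  assumes "\<And>\<Phi>. norm \<Phi> \<le> 1 \<Longrightarrow> lp_norm q n (\<lambda>i. cblinfun_apply \<Phi> (ys i)) \<le> c"
  shows "weak_lp_norm_dual q n ys \<le> c"
  unfolding weak_lp_norm_dual_def by (rule cSUP_least) (use assms in auto)

text \<open>
  Evaluation at \<open>y\<close> is the element \<open>\<kappa> y\<close> of the bidual, of norm at most that of \<open>y\<close>. This is how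
  the weak norm controls values of the functionals on \<open>F\<close> itself.
\<close>

lemma lp_norm_eval_le_weak:
  "lp_norm q n (\<lambda>i. cblinfun_apply (ys i) y) \<le> norm y * weak_lp_norm_dual q n ys"
proof -
  have "lp_norm q n (\<lambda>i. cblinfun_apply (ys i) y)
      \<le> norm (cblinfun_apply canonical_embedding y) * weak_lp_norm_dual q n ys"
    using lp_norm_le_weak[of "cblinfun_apply canonical_embedding y"]
    by (simp add: canonical_embedding_apply)
  also have "\<dots> \<le> norm y * weak_lp_norm_dual q n ys"
    by (intro mult_right_mono norm_canonical_embedding_apply weak_lp_norm_nonneg)
  finally show ?thesis .
qed

end

text \<open>
  If \<open>\<Phi>\<close> is in the unit ball of the bidual of \<open>G\<close>, then \<open>\<Phi> \<circ> T\<close> is an element of the bidual of \<open>F\<close>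
  with norm at most that of \<open>T\<close>. The two uses are \<open>T = S\<^sup>*\<close>, for compositions with an operator \<open>S\<close>,
  and \<open>T = \<kappa>\<close> from \<open>F\<^sup>*\<close> to its bidual, for regularity.
\<close>

lemma weak_lp_norm_image:
  fixes T :: "('f::cbanach cdual, 'g::cbanach cdual) cblinfun"
  assumes "1 \<le> q" "1 \<le> n"
  shows "weak_lp_norm_dual q n (\<lambda>i. cblinfun_apply T (ys i)) \<le> norm T * weak_lp_norm_dual q n ys"
proof (rule weak_lp_norm_least[OF assms])
  fix \<Phi> :: "'g cdual cdual" assume \<Phi>: "norm \<Phi> \<le> 1"
  have "lp_norm q n (\<lambda>i. cblinfun_apply \<Phi> (cblinfun_apply T (ys i)))
      \<le> norm (cblinfun_compose \<Phi> T) * weak_lp_norm_dual q n ys"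
    using lp_norm_le_weak[OF assms, of "cblinfun_compose \<Phi> T" ys]
    by (simp add: cblinfun_compose_apply)
  also have "\<dots> \<le> norm T * weak_lp_norm_dual q n ys"
    using norm_cblinfun_compose[of \<Phi> T] mult_right_mono[OF \<Phi>, of "norm T"]
    by (intro mult_right_mono weak_lp_norm_nonneg[OF assms]) simp
  finally show "lp_norm q n (\<lambda>i. cblinfun_apply \<Phi> (cblinfun_apply T (ys i)))
      \<le> norm T * weak_lp_norm_dual q n ys" .
qed

lemma weak_lp_norm_single:
  fixes ys :: "nat \<Rightarrow> 'f::cbanach cdual"
  assumes "1 \<le> q"
  shows "weak_lp_norm_dual q 1 ys \<le> norm (ys 0)"
proof (rule weak_lp_norm_least[OF assms])
  fix \<Phi> :: "'f cdual cdual" assume "norm \<Phi> \<le> 1"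
  then show "lp_norm q 1 (\<lambda>i. cblinfun_apply \<Phi> (ys i)) \<le> norm (ys 0)"
    using norm_cblinfun_apply_le[of \<Phi> "ys 0"] mult_right_mono[of "norm \<Phi>" 1 "norm (ys 0)"]
    unfolding lp_norm_single[OF assms] by simp
qed simp

section \<open>Constants in the Cohen summing inequality\<close>

lemma cohen_boundI:
  assumes "0 \<le> C"
    and "\<And>n ls xs ys. 1 \<le> n \<Longrightarrow> (\<And>i. i < n \<Longrightarrow> xs i \<in> U) \<Longrightarrow>
      (\<Sum>i<n. cmod (ls i) * cmod (cblinfun_apply (ys i) (f (xs i))))
        \<le> C * lp_norm p n ls * weak_lp_norm_dual (conj_index p) n ys"
  shows "cohen_bound p U f C"
  using assms by (auto simp: cohen_bound_def)

lemma cohen_boundD: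
  assumes "cohen_bound p U f C" "1 \<le> n" "\<And>i. i < n \<Longrightarrow> xs i \<in> U"
  shows "(\<Sum>i<n. cmod (ls i) * cmod (cblinfun_apply (ys i) (f (xs i))))
        \<le> C * lp_norm p n ls * weak_lp_norm_dual (conj_index p) n ys"
  using assms by (auto simp: cohen_bound_def)

lemma cohen_bound_nonneg: "cohen_bound p U f C \<Longrightarrow> 0 \<le> C"
  by (simp add: cohen_bound_def)

lemma cblinfun_apply_add: "cblinfun_apply T (x + y) = cblinfun_apply T x + cblinfun_apply T y"
  by (simp add: bounded_linear.linear[THEN linear_add] bounded_linear_cblinfun_apply)

lemma cblinfun_apply_zero: "cblinfun_apply T 0 = 0"
  by (simp add: bounded_linear.linear[THEN linear_0] bounded_linear_cblinfun_apply)

lemma cohen_bound_zero: "cohen_bound p U (\<lambda>_. 0) 0"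
  by (rule cohen_boundI) (simp_all add: cblinfun_apply_zero)

lemma cohen_bound_add:
  assumes f: "cohen_bound p U f C" and g: "cohen_bound p U g D"
  shows "cohen_bound p U (\<lambda>x. f x + g x) (C + D)"
proof (rule cohen_boundI)
  show "0 \<le> C + D" using assms[THEN cohen_bound_nonneg] by simp
  fix n and ls :: "nat \<Rightarrow> complex" and xs :: "nat \<Rightarrow> 'a" and ys :: "nat \<Rightarrow> 'b cdual"
  assume n: "1 \<le> n" and xs: "\<And>i. i < n \<Longrightarrow> xs i \<in> U"
  have "(\<Sum>i<n. cmod (ls i) * cmod (cblinfun_apply (ys i) (f (xs i) + g (xs i))))
      \<le> (\<Sum>i<n. cmod (ls i) * cmod (cblinfun_apply (ys i) (f (xs i)))
              + cmod (ls i) * cmod (cblinfun_apply (ys i) (g (xs i))))"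
    unfolding cblinfun_apply_add distrib_left[symmetric]
    by (intro sum_mono mult_left_mono norm_triangle_ineq) simp
  also have "\<dots> \<le> C * lp_norm p n ls * weak_lp_norm_dual (conj_index p) n ys
      + D * lp_norm p n ls * weak_lp_norm_dual (conj_index p) n ys"
    unfolding sum.distrib by (intro add_mono cohen_boundD[OF f n] cohen_boundD[OF g n] xs)
  finally show "(\<Sum>i<n. cmod (ls i) * cmod (cblinfun_apply (ys i) (f (xs i) + g (xs i))))
      \<le> (C + D) * lp_norm p n ls * weak_lp_norm_dual (conj_index p) n ys"
    by (simp add: algebra_simps)
qed

lemma cohen_bound_scaleC:
  assumes "cohen_bound p U f C"
  shows "cohen_bound p U (\<lambda>x. c *\<^sub>C f x) (cmod c * C)"
proof (rule cohen_boundI)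
  show "0 \<le> cmod c * C" using cohen_bound_nonneg[OF assms] by simp
  fix n and ls :: "nat \<Rightarrow> complex" and xs :: "nat \<Rightarrow> 'a" and ys :: "nat \<Rightarrow> 'b cdual"
  assume n: "1 \<le> n" and xs: "\<And>i. i < n \<Longrightarrow> xs i \<in> U"
  have "(\<Sum>i<n. cmod (ls i) * cmod (cblinfun_apply (ys i) (c *\<^sub>C f (xs i))))
      = cmod c * (\<Sum>i<n. cmod (ls i) * cmod (cblinfun_apply (ys i) (f (xs i))))"
    by (simp add: cblinfun_apply_scaleC norm_scaleC sum_distrib_left mult.left_commute)
  also have "\<dots> \<le> cmod c * (C * lp_norm p n ls * weak_lp_norm_dual (conj_index p) n ys)"
    by (intro mult_left_mono cohen_boundD[OF assms n] xs) auto
  finally show "(\<Sum>i<n. cmod (ls i) * cmod (cblinfun_apply (ys i) (c *\<^sub>C f (xs i))))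
      \<le> cmod c * C * lp_norm p n ls * weak_lp_norm_dual (conj_index p) n ys"
    by (simp add: mult.assoc)
qed

text \<open>
  For each choice of scalars, points and functionals both sides of the defining inequality are
  fixed except for finitely many values of the mapping, so a constant passes to pointwise limits.
\<close>

lemma cohen_bound_limit:
  assumes lim: "\<And>x. x \<in> U \<Longrightarrow> (\<lambda>k. F k x) \<longlonglongrightarrow> f x"
    and bound: "\<forall>\<^sub>F k in sequentially. cohen_bound p U (F k) C"
  shows "cohen_bound p U f C"
proof (rule cohen_boundI)
  show "0 \<le> C"
    using bound by (auto dest!: eventually_happens' [OF sequentially_bot] cohen_bound_nonneg)
  fix n and ls :: "nat \<Rightarrow> complex" and xs :: "nat \<Rightarrow> 'a" and ys :: "nat \<Rightarrow> 'b cdual"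
  assume n: "1 \<le> n" and xs: "\<And>i. i < n \<Longrightarrow> xs i \<in> U"
  show "(\<Sum>i<n. cmod (ls i) * cmod (cblinfun_apply (ys i) (f (xs i))))
      \<le> C * lp_norm p n ls * weak_lp_norm_dual (conj_index p) n ys"
  proof (rule tendsto_upperbound)
    show "(\<lambda>k. \<Sum>i<n. cmod (ls i) * cmod (cblinfun_apply (ys i) (F k (xs i))))
        \<longlonglongrightarrow> (\<Sum>i<n. cmod (ls i) * cmod (cblinfun_apply (ys i) (f (xs i))))"
      by (intro tendsto_intros bounded_linear.tendsto[OF bounded_linear_cblinfun_apply] lim)
        (use xs in auto)
    show "\<forall>\<^sub>F k in sequentially.
        (\<Sum>i<n. cmod (ls i) * cmod (cblinfun_apply (ys i) (F k (xs i))))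
          \<le> C * lp_norm p n ls * weak_lp_norm_dual (conj_index p) n ys"
      using bound by eventually_elim (rule cohen_boundD[OF _ n xs])
  qed simp
qed

context
  fixes p :: ennreal
  assumes p: "1 \<le> p"
begin

lemma weight_nonneg:
  "1 \<le> n \<Longrightarrow> 0 \<le> lp_norm p n ls * weak_lp_norm_dual (conj_index p) n ys"
  by (intro mult_nonneg_nonneg lp_norm_nonneg weak_lp_norm_nonneg conj_index_ge_1[OF p])

lemma cohen_bound_mono:
  assumes f: "cohen_bound p U f C" and le: "C \<le> D"
  shows "cohen_bound p U f D"
proof (rule cohen_boundI)
  show "0 \<le> D" using cohen_bound_nonneg[OF f] le by simp
  fix n and ls :: "nat \<Rightarrow> complex" and xs :: "nat \<Rightarrow> 'a" and ys :: "nat \<Rightarrow> 'b cdual"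
  assume n: "1 \<le> n" and xs: "\<And>i. i < n \<Longrightarrow> xs i \<in> U"
  have "(\<Sum>i<n. cmod (ls i) * cmod (cblinfun_apply (ys i) (f (xs i))))
      \<le> C * (lp_norm p n ls * weak_lp_norm_dual (conj_index p) n ys)"
    using cohen_boundD[OF f n xs] by (simp add: mult.assoc)
  also have "\<dots> \<le> D * (lp_norm p n ls * weak_lp_norm_dual (conj_index p) n ys)"
    by (intro mult_right_mono le weight_nonneg n)
  finally show "(\<Sum>i<n. cmod (ls i) * cmod (cblinfun_apply (ys i) (f (xs i))))
      \<le> D * lp_norm p n ls * weak_lp_norm_dual (conj_index p) n ys"
    by (simp add: mult.assoc)
qed

text \<open>
  A functional \<open>y\<^sup>*\<close> evaluated at \<open>S (f (h x))\<close> is \<open>S\<^sup>* y\<^sup>*\<close> evaluated at \<open>f (h x)\<close>. The points \<open>h x\<close>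
  are again points of \<open>U\<close>, and \<open>S\<^sup>*\<close> enlarges the weak norm at most by the factor \<open>norm S\<close>.
\<close>

lemma cohen_bound_compose:
  assumes f: "cohen_bound p U f C" and h: "h ` V \<subseteq> U"
  shows "cohen_bound p V (zero_ext V (cblinfun_apply S \<circ> f \<circ> h)) (norm S * C)"
proof (rule cohen_boundI)
  show "0 \<le> norm S * C" using cohen_bound_nonneg[OF f] by simp
  fix n and ls :: "nat \<Rightarrow> complex" and xs :: "nat \<Rightarrow> 'c" and ys :: "nat \<Rightarrow> 'd cdual"
  assume n: "1 \<le> n" and xs: "\<And>i. i < n \<Longrightarrow> xs i \<in> V"
  define zs where "zs i = cblinfun_apply (cblinfun_transpose S) (ys i)" for i
  have zs: "cblinfun_apply (zs i) y = cblinfun_apply (ys i) (cblinfun_apply S y)" for i y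
    by (simp add: zs_def cblinfun_transpose_apply cblinfun_compose_apply)
  have "weak_lp_norm_dual (conj_index p) n zs
      \<le> norm (cblinfun_transpose S) * weak_lp_norm_dual (conj_index p) n ys"
    unfolding zs_def by (rule weak_lp_norm_image[OF conj_index_ge_1[OF p] n])
  also have "\<dots> \<le> norm S * weak_lp_norm_dual (conj_index p) n ys"
    by (intro mult_right_mono norm_cblinfun_transpose weak_lp_norm_nonneg conj_index_ge_1[OF p] n)
  finally have weak: "weak_lp_norm_dual (conj_index p) n zs
      \<le> norm S * weak_lp_norm_dual (conj_index p) n ys" .
  have "(\<Sum>i<n. cmod (ls i) * cmod (cblinfun_apply (ys i) (zero_ext V (cblinfun_apply S \<circ> f \<circ> h) (xs i))))
      = (\<Sum>i<n. cmod (ls i) * cmod (cblinfun_apply (zs i) (f (h (xs i)))))"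
    using xs by (simp add: zero_ext_def zs)
  also have "\<dots> \<le> C * lp_norm p n ls * weak_lp_norm_dual (conj_index p) n zs"
    by (rule cohen_boundD[OF f n]) (use xs h in auto)
  also have "\<dots> \<le> C * lp_norm p n ls * (norm S * weak_lp_norm_dual (conj_index p) n ys)"
    by (intro mult_left_mono weak mult_nonneg_nonneg cohen_bound_nonneg[OF f] lp_norm_nonneg n)
  finally show "(\<Sum>i<n. cmod (ls i) * cmod (cblinfun_apply (ys i)
        (zero_ext V (cblinfun_apply S \<circ> f \<circ> h) (xs i))))
      \<le> norm S * C * lp_norm p n ls * weak_lp_norm_dual (conj_index p) n ys"
    by (simp add: mult_ac)
qed

text \<open>
  The case \<open>n = 1\<close> of the defining inequality, with a functional that norms \<open>f x\<close>.
\<close>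

lemma norm_le_cohen_bound:
  assumes f: "cohen_bound p U f C" and x: "x \<in> U"
  shows "norm (f x) \<le> C"
proof -
  obtain \<phi> :: "'b cdual" where \<phi>: "norm \<phi> \<le> 1" "cmod (cblinfun_apply \<phi> (f x)) = norm (f x)"
    by (rule norming_functional_exists)
  have "norm (f x) \<le> C * weak_lp_norm_dual (conj_index p) 1 (\<lambda>_. \<phi>)"
    using cohen_boundD[OF f, of 1 "\<lambda>_. x" "\<lambda>_. 1" "\<lambda>_. \<phi>"] x \<phi>(2)
    unfolding lp_norm_single[OF p] by (simp add: lessThan_Suc)
  also have "\<dots> \<le> C * 1"
    using weak_lp_norm_single[OF conj_index_ge_1[OF p], of "\<lambda>_. \<phi>"] \<phi>(1)
    by (intro mult_left_mono cohen_bound_nonneg[OF f]) linarith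
  finally show ?thesis by simp
qed

text \<open>
  After \<open>g\<close> has been estimated by \<open>K\<close>, the points disappear from the sum. Hoelder's inequality then
  separates the scalars from the values of the functionals at \<open>y\<close>.
\<close>

lemma cohen_bound_scaleC_const:
  fixes y :: "'f::cbanach"
  assumes "0 \<le> K" "\<And>x. x \<in> U \<Longrightarrow> cmod (g x) \<le> K"
  shows "cohen_bound p U (\<lambda>x. g x *\<^sub>C y) (K * norm y)"
proof (rule cohen_boundI)
  show "0 \<le> K * norm y" using assms by simp
  fix n and ls :: "nat \<Rightarrow> complex" and xs :: "nat \<Rightarrow> 'a" and ys :: "nat \<Rightarrow> 'f cdual"
  assume n: "1 \<le> n" and xs: "\<And>i. i < n \<Longrightarrow> xs i \<in> U"
  have "(\<Sum>i<n. cmod (ls i) * cmod (cblinfun_apply (ys i) (g (xs i) *\<^sub>C y)))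
      \<le> (\<Sum>i<n. K * (cmod (ls i) * cmod (cblinfun_apply (ys i) y)))"
  proof (rule sum_mono)
    fix i assume "i \<in> {..<n}"
    then have "cmod (g (xs i)) * (cmod (ls i) * cmod (cblinfun_apply (ys i) y))
        \<le> K * (cmod (ls i) * cmod (cblinfun_apply (ys i) y))"
      by (intro mult_right_mono assms xs) auto
    then show "cmod (ls i) * cmod (cblinfun_apply (ys i) (g (xs i) *\<^sub>C y))
        \<le> K * (cmod (ls i) * cmod (cblinfun_apply (ys i) y))"
      by (simp add: cblinfun_apply_scaleC norm_scaleC mult.left_commute)
  qed
  also have "\<dots> \<le> K * (lp_norm p n ls * lp_norm (conj_index p) n (\<lambda>i. cblinfun_apply (ys i) y))"
    unfolding sum_distrib_left[symmetric]
    by (intro mult_left_mono lp_norm_Holder p assms)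
  also have "\<dots> \<le> K * (lp_norm p n ls * (norm y * weak_lp_norm_dual (conj_index p) n ys))"
    by (intro mult_left_mono lp_norm_eval_le_weak conj_index_ge_1[OF p] n lp_norm_nonneg assms)
  finally show "(\<Sum>i<n. cmod (ls i) * cmod (cblinfun_apply (ys i) (g (xs i) *\<^sub>C y)))
      \<le> K * norm y * lp_norm p n ls * weak_lp_norm_dual (conj_index p) n ys"
    by (simp add: mult_ac)
qed

text \<open>
  The functionals \<open>y\<^sup>*\<close> on \<open>F\<close> are tested as functionals on the bidual by passing to \<open>\<kappa> y\<^sup>*\<close>, since
  \<open>(\<kappa> y\<^sup>*)(\<kappa> y) = y\<^sup>*(y)\<close>; this does not increase their weak norm.
\<close>

lemma cohen_bound_of_bidual:
  fixes f :: "'e::cbanach \<Rightarrow> 'f::cbanach"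
  assumes f: "cohen_bound p U (cblinfun_apply canonical_embedding \<circ> f) C"
  shows "cohen_bound p U f C"
proof (rule cohen_boundI)
  show C: "0 \<le> C" by (rule cohen_bound_nonneg[OF f])
  fix n and ls :: "nat \<Rightarrow> complex" and xs :: "nat \<Rightarrow> 'e" and ys :: "nat \<Rightarrow> 'f cdual"
  assume n: "1 \<le> n" and xs: "\<And>i. i < n \<Longrightarrow> xs i \<in> U"
  define zs where "zs i = cblinfun_apply canonical_embedding (ys i)" for i
  have "weak_lp_norm_dual (conj_index p) n zs
      \<le> norm (canonical_embedding :: ('f cdual, _) cblinfun) * weak_lp_norm_dual (conj_index p) n ys"
    unfolding zs_def by (rule weak_lp_norm_image[OF conj_index_ge_1[OF p] n])
  also have "\<dots> \<le> 1 * weak_lp_norm_dual (conj_index p) n ys"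
    by (intro mult_right_mono norm_canonical_embedding weak_lp_norm_nonneg conj_index_ge_1[OF p] n)
  finally have weak: "weak_lp_norm_dual (conj_index p) n zs \<le> weak_lp_norm_dual (conj_index p) n ys"
    by simp
  have "(\<Sum>i<n. cmod (ls i) * cmod (cblinfun_apply (ys i) (f (xs i))))
      = (\<Sum>i<n. cmod (ls i) * cmod (cblinfun_apply (zs i)
          ((cblinfun_apply canonical_embedding \<circ> f) (xs i))))"
    by (simp add: zs_def canonical_embedding_apply)
  also have "\<dots> \<le> C * lp_norm p n ls * weak_lp_norm_dual (conj_index p) n zs"
    by (rule cohen_boundD[OF f n xs])
  also have "\<dots> \<le> C * lp_norm p n ls * weak_lp_norm_dual (conj_index p) n ys"
    by (intro mult_left_mono weak mult_nonneg_nonneg C lp_norm_nonneg n)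
  finally show "(\<Sum>i<n. cmod (ls i) * cmod (cblinfun_apply (ys i) (f (xs i))))
      \<le> C * lp_norm p n ls * weak_lp_norm_dual (conj_index p) n ys" .
qed

lemma cohen_norm_le: "cohen_bound p U f C \<Longrightarrow> cohen_norm p U f \<le> C"
  unfolding cohen_norm_def
  by (rule cInf_lower) (auto intro!: bdd_belowI[of _ 0] dest: cohen_bound_nonneg)

text \<open>
  The infimum defining the norm is attained, because each instance of the inequality has the form
  \<open>L \<le> C * W\<close> with \<open>W \<ge> 0\<close> and so defines a closed set of constants \<open>C\<close>. The properties of the norm
  can therefore be read off from those of the constants.
\<close>

lemma cohen_bound_cohen_norm:
  assumes "f \<in> cohen_summing p U"
  shows "cohen_bound p U f (cohen_norm p U f)"
proof -
  have ne: "{C. cohen_bound p U f C} \<noteq> {}"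
    using assms by (auto simp: cohen_summing_def)
  have greatest: "b \<le> cohen_norm p U f" if "\<And>C. cohen_bound p U f C \<Longrightarrow> b \<le> C" for b
    unfolding cohen_norm_def by (rule cInf_greatest[OF ne]) (use that in simp)
  show ?thesis
  proof (rule cohen_boundI)
    show "0 \<le> cohen_norm p U f"
      by (rule greatest) (rule cohen_bound_nonneg)
    fix n and ls :: "nat \<Rightarrow> complex" and xs :: "nat \<Rightarrow> 'a" and ys :: "nat \<Rightarrow> 'b cdual"
    assume n: "1 \<le> n" and xs: "\<And>i. i < n \<Longrightarrow> xs i \<in> U"
    define L where "L = (\<Sum>i<n. cmod (ls i) * cmod (cblinfun_apply (ys i) (f (xs i))))"
    define W where "W = lp_norm p n ls * weak_lp_norm_dual (conj_index p) n ys"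
    have W: "0 \<le> W" unfolding W_def by (rule weight_nonneg[OF n])
    have LW: "L \<le> C * W" if "cohen_bound p U f C" for C
      using cohen_boundD[OF that n xs, where ls = ls and ys = ys]
      by (simp add: L_def W_def mult.assoc)
    have "L \<le> cohen_norm p U f * W"
    proof (cases "W = 0")
      case True
      with LW ne show ?thesis by auto
    next
      case False
      with W have "0 < W" by simp
      with LW have "L / W \<le> cohen_norm p U f"
        by (intro greatest) (simp add: pos_divide_le_eq)
      with \<open>0 < W\<close> show ?thesis by (simp add: pos_divide_le_eq)
    qed
    then show "(\<Sum>i<n. cmod (ls i) * cmod (cblinfun_apply (ys i) (f (xs i))))
        \<le> cohen_norm p U f * lp_norm p n ls * weak_lp_norm_dual (conj_index p) n ys"
      by (simp add: L_def W_def mult.assoc)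
  qed
qed

end

text \<open>
  For \<open>p = 1\<close> the weak norm is a maximum, and it bounds every single functional on the unit ball
  of \<open>F\<close>. Boundedness of \<open>f\<close> then suffices.
\<close>

lemma cohen_bound_1:
  fixes f :: "'e::cbanach \<Rightarrow> 'f::cbanach"
  assumes K: "0 \<le> K" "\<And>x. x \<in> U \<Longrightarrow> norm (f x) \<le> K"
  shows "cohen_bound 1 U f K"
proof (rule cohen_boundI)
  fix n and ls :: "nat \<Rightarrow> complex" and xs :: "nat \<Rightarrow> 'e" and ys :: "nat \<Rightarrow> 'f cdual"
  assume n: "1 \<le> n" and xs: "\<And>i. i < n \<Longrightarrow> xs i \<in> U"
  define W where "W = weak_lp_norm_dual \<infinity> n ys"
  have W: "0 \<le> W" unfolding W_def by (rule weak_lp_norm_nonneg[OF _ n]) simp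
  have "cmod (cblinfun_apply (ys i) (f (xs i))) \<le> K * W" if i: "i < n" for i
  proof -
    have "cmod (cblinfun_apply (ys i) (f (xs i)))
        \<le> lp_norm \<infinity> n (\<lambda>j. cblinfun_apply (ys j) (f (xs i)))"
      by (rule cmod_le_lp_norm_infinity[OF i])
    also have "\<dots> \<le> norm (f (xs i)) * W"
      unfolding W_def by (rule lp_norm_eval_le_weak[OF _ n]) simp
    also have "\<dots> \<le> K * W" by (intro mult_right_mono K xs i W)
    finally show ?thesis .
  qed
  then have "(\<Sum>i<n. cmod (ls i) * cmod (cblinfun_apply (ys i) (f (xs i))))
      \<le> (\<Sum>i<n. cmod (ls i) * (K * W))"
    by (intro sum_mono mult_left_mono) auto
  also have "\<dots> = K * lp_norm 1 n ls * W"
    by (simp add: lp_norm_one sum_distrib_left sum_distrib_right mult_ac)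
  finally show "(\<Sum>i<n. cmod (ls i) * cmod (cblinfun_apply (ys i) (f (xs i))))
      \<le> K * lp_norm 1 n ls * weak_lp_norm_dual (conj_index 1) n ys"
    by (simp add: W_def conj_index_def)
qed (rule K)

section \<open>Holomorphic mappings and their uniform limits\<close>

lemma Hol_off: "f \<in> Hol U \<Longrightarrow> x \<notin> U \<Longrightarrow> f x = 0"
  by (simp add: Hol_def)

lemma Hol_has_derivative:
  fixes f :: "'e::cbanach \<Rightarrow> 'f::cbanach"
  assumes "f \<in> Hol U" "x \<in> U"
  obtains D :: "('e, 'f) cblinfun" where "(f has_derivative cblinfun_apply D) (at x)"
  using assms by (auto simp: Hol_def)

lemma HolI:
  fixes f :: "'e::cbanach \<Rightarrow> 'f::cbanach"
  assumes "\<And>x. x \<in> U \<Longrightarrow> \<exists>D :: ('e, 'f) cblinfun. (f has_derivative cblinfun_apply D) (at x)"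
    and "\<And>x. x \<notin> U \<Longrightarrow> f x = 0"
  shows "f \<in> Hol U"
  using assms by (simp add: Hol_def)

lemma Hol_zero: "(\<lambda>_. 0) \<in> Hol U"
  by (rule HolI) (auto intro!: exI[of _ 0] simp: zero_apply[abs_def])

lemma Hol_add:
  fixes f g :: "'e::cbanach \<Rightarrow> 'f::cbanach"
  assumes "f \<in> Hol U" "g \<in> Hol U"
  shows "(\<lambda>x. f x + g x) \<in> Hol U"
proof (rule HolI)
  fix x assume x: "x \<in> U"
  obtain D D' :: "('e, 'f) cblinfun" where
    "(f has_derivative cblinfun_apply D) (at x)" "(g has_derivative cblinfun_apply D') (at x)"
    using assms[THEN Hol_has_derivative, OF x] by metis
  then have "((\<lambda>x. f x + g x) has_derivative cblinfun_apply (D + D')) (at x)"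
    unfolding plus_apply[abs_def] by (rule has_derivative_add)
  then show "\<exists>D :: ('e, 'f) cblinfun. ((\<lambda>x. f x + g x) has_derivative cblinfun_apply D) (at x)"
    by blast
qed (simp add: assms[THEN Hol_off])

lemma Hol_postcompose:
  fixes f :: "'e::cbanach \<Rightarrow> 'f::cbanach" and S :: "('f, 'g::cbanach) cblinfun"
  assumes "f \<in> Hol U"
  shows "(\<lambda>x. cblinfun_apply S (f x)) \<in> Hol U"
proof (rule HolI)
  fix x assume x: "x \<in> U"
  obtain D :: "('e, 'f) cblinfun" where "(f has_derivative cblinfun_apply D) (at x)"
    using Hol_has_derivative[OF assms x] by metis
  then have "((\<lambda>x. cblinfun_apply S (f x)) has_derivative
      cblinfun_apply (cblinfun_compose S D)) (at x)"
    unfolding cblinfun_compose_apply[abs_def]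
    by (rule bounded_linear.has_derivative[OF bounded_linear_cblinfun_apply])
  then show "\<exists>D :: ('e, 'g) cblinfun.
      ((\<lambda>x. cblinfun_apply S (f x)) has_derivative cblinfun_apply D) (at x)"
    by blast
qed (simp add: Hol_off[OF assms] cblinfun_apply_zero)

lemma Hol_precompose:
  fixes f :: "'e::cbanach \<Rightarrow> 'f::cbanach" and h :: "'h::cbanach \<Rightarrow> 'e"
  assumes f: "f \<in> Hol U" and h: "h \<in> Hol_into V U" and V: "open V"
  shows "zero_ext V (f \<circ> h) \<in> Hol V"
proof (rule HolI)
  fix x assume x: "x \<in> V"
  have hH: "h \<in> Hol V" and hx: "h x \<in> U"
    using h x by (auto simp: Hol_into_def)
  obtain D :: "('h, 'e) cblinfun" where D: "(h has_derivative cblinfun_apply D) (at x)"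
    using Hol_has_derivative[OF hH x] by metis
  obtain D' :: "('e, 'f) cblinfun" where D': "(f has_derivative cblinfun_apply D') (at (h x))"
    using Hol_has_derivative[OF f hx] by metis
  have "(f \<circ> h has_derivative cblinfun_apply (cblinfun_compose D' D)) (at x)"
    using diff_chain_at[OF D D'] by (simp add: cblinfun_compose_apply[abs_def] comp_def)
  then have "(zero_ext V (f \<circ> h) has_derivative cblinfun_apply (cblinfun_compose D' D)) (at x)"
    by (rule has_derivative_transform_within_open[OF _ V x]) (simp add: zero_ext_def)
  then show "\<exists>D :: ('h, 'f) cblinfun. (zero_ext V (f \<circ> h) has_derivative cblinfun_apply D) (at x)"
    by blast
qed (simp add: zero_ext_def)

definition scaleC_left_op :: "'a::complex_normed_vector \<Rightarrow> (complex, 'a) cblinfun"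
  where "scaleC_left_op y = CBlinfun (\<lambda>z. z *\<^sub>C y)"

lemma scaleC_left_op_apply: "cblinfun_apply (scaleC_left_op y) z = z *\<^sub>C y"
  unfolding scaleC_left_op_def
proof (rule CBlinfun_apply)
  show "bounded_linear (\<lambda>z. z *\<^sub>C y)"
    by (rule bounded_linear_intro[where K = "norm y"])
      (simp_all add: scaleC_add_left scaleR_scaleC scaleC_scaleC norm_scaleC scaleC_complex_def)
qed (simp add: scaleC_scaleC scaleC_complex_def)

definition scaleC_op :: "complex \<Rightarrow> ('a::complex_normed_vector, 'a) cblinfun"
  where "scaleC_op c = CBlinfun (\<lambda>x. c *\<^sub>C x)"

lemma scaleC_op_apply: "cblinfun_apply (scaleC_op c) x = c *\<^sub>C x"
  unfolding scaleC_op_def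
  by (rule CBlinfun_apply) (simp_all add: bounded_linear_scaleC scaleC_scaleC mult.commute)

lemma Hol_scaleC: "f \<in> Hol U \<Longrightarrow> (\<lambda>x. c *\<^sub>C f x) \<in> Hol U"
  using Hol_postcompose[of f U "scaleC_op c"] by (simp add: scaleC_op_apply)

lemma Hol_scaleC_const: "g \<in> Hol U \<Longrightarrow> (\<lambda>x. g x *\<^sub>C y) \<in> Hol U"
  using Hol_postcompose[of g U "scaleC_left_op y"] by (simp add: scaleC_left_op_apply)

lemma scaleC_minus_one: "(- 1) *\<^sub>C x = - (x :: 'a::complex_vector)"
  using scaleR_scaleC[of "- 1" x] by simp

lemma Hol_diff: "f \<in> Hol U \<Longrightarrow> g \<in> Hol U \<Longrightarrow> (\<lambda>x. f x - g x) \<in> Hol U"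
  using Hol_add[OF _ Hol_scaleC[of g U "- 1"]] by (simp add: scaleC_minus_one)

text \<open>
  In a direction \<open>v\<close>, the one-variable function \<open>t \<mapsto> \<phi> (f (x + t v))\<close> is holomorphic on the disc of
  radius \<open>r / norm v\<close> and its derivative at \<open>0\<close> is \<open>\<phi> (D v)\<close>. If \<open>\<phi>\<close> norms \<open>D v\<close>, the classical Cauchy
  inequality for this function is the desired estimate.
\<close>

lemma Cauchy_estimate_derivative:
  fixes f :: "'e::cbanach \<Rightarrow> 'f::cbanach"
  assumes f: "f \<in> Hol U" and r: "0 < r" and ball: "cball x r \<subseteq> U"
    and bound: "\<And>y. y \<in> cball x r \<Longrightarrow> norm (f y) \<le> M"
    and D: "(f has_derivative cblinfun_apply D) (at x)"
  shows "norm D \<le> M / r"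
proof (rule norm_cblinfun_leI)
  have "0 \<le> norm (f x)" by simp
  also have "\<dots> \<le> M" using bound[of x] r by simp
  finally have "0 \<le> M" .
  then show "0 \<le> M / r" using r by simp
  fix v
  show "norm (cblinfun_apply D v) \<le> M / r * norm v"
  proof (cases "v = 0")
    case False
    define \<rho> where "\<rho> = r / norm v"
    have \<rho>: "0 < \<rho>" using r False by (simp add: \<rho>_def)
    obtain \<phi> :: "'f cdual" where \<phi>: "norm \<phi> \<le> 1"
      "cmod (cblinfun_apply \<phi> (cblinfun_apply D v)) = norm (cblinfun_apply D v)"
      by (rule norming_functional_exists)
    define g where "g t = cblinfun_apply \<phi> (f (x + t *\<^sub>C v))" for t
    have in_ball: "x + t *\<^sub>C v \<in> cball x r" if "cmod t \<le> \<rho>" for t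
      using that False by (simp add: dist_norm norm_scaleC \<rho>_def field_simps)
    have deriv: "(g has_field_derivative cblinfun_apply \<phi> (cblinfun_apply D' v)) (at t)"
      if D': "(f has_derivative cblinfun_apply D') (at (x + t *\<^sub>C v))" for t D'
    proof -
      have "((\<lambda>t. x + cblinfun_apply (scaleC_left_op v) t) has_derivative
          (\<lambda>s. 0 + cblinfun_apply (scaleC_left_op v) s)) (at t)"
        by (intro has_derivative_add has_derivative_const bounded_linear_imp_has_derivative
            bounded_linear_cblinfun_apply)
      then have "((\<lambda>t. x + t *\<^sub>C v) has_derivative (\<lambda>s. s *\<^sub>C v)) (at t)"
        by (simp add: scaleC_left_op_apply)
      from diff_chain_at[OF this D']
      have "((\<lambda>t. f (x + t *\<^sub>C v)) has_derivative (\<lambda>s. cblinfun_apply D' (s *\<^sub>C v))) (at t)"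
        by (simp add: comp_def)
      from bounded_linear.has_derivative[OF bounded_linear_cblinfun_apply[of \<phi>] this]
      show ?thesis
        unfolding has_field_derivative_def g_def
        by (simp add: cblinfun_apply_scaleC scaleC_complex_def mult_commute_abs)
    qed
    have deriv_ex: "\<exists>d. (g has_field_derivative d) (at t)" if "cmod t \<le> \<rho>" for t
    proof -
      have "x + t *\<^sub>C v \<in> U"
        using in_ball[OF that] ball by blast
      from Hol_has_derivative[OF f this] obtain D' :: "('e, 'f) cblinfun"
        where "(f has_derivative cblinfun_apply D') (at (x + t *\<^sub>C v))"
        by metis
      from deriv[OF this] show ?thesis by blast
    qed
    have "norm ((deriv ^^ 1) g 0) \<le> fact 1 * M / \<rho> ^ 1"
    proof (rule Cauchy_inequality)
      show "g holomorphic_on ball 0 \<rho>"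
        using deriv_ex by (auto simp: holomorphic_on_open)
      show "continuous_on (cball 0 \<rho>) g"
      proof (intro continuous_at_imp_continuous_on ballI)
        fix t :: complex assume "t \<in> cball 0 \<rho>"
        then obtain d where "(g has_field_derivative d) (at t)"
          using deriv_ex by auto
        then show "isCont g t" by (rule DERIV_isCont)
      qed
      show "norm (g t) \<le> M" if "norm (0 - t) = \<rho>" for t
      proof -
        have "norm (g t) \<le> norm \<phi> * norm (f (x + t *\<^sub>C v))"
          unfolding g_def by (rule norm_cblinfun_apply_le)
        also have "\<dots> \<le> 1 * M"
          by (intro mult_mono \<phi> bound in_ball) (use that in auto)
        finally show ?thesis by simp
      qed
    qed (rule \<rho>)
    moreover have "deriv g 0 = cblinfun_apply \<phi> (cblinfun_apply D v)"
      by (rule DERIV_imp_deriv, rule deriv) (use D scaleC_left_op_apply[of v 0] in \<open>simp add: cblinfun_apply_zero\<close>)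
    ultimately show ?thesis
      using False r by (simp add: \<phi>(2) \<rho>_def)
  qed (simp add: cblinfun_apply_zero)
qed

text \<open>
  The Cauchy estimate transfers the uniform Cauchy property from the mappings to their
  derivatives, on a smaller ball. The derivatives then converge uniformly in the Banach space of
  complex-linear operators, and the limit may be differentiated term by term; that the limit
  derivative is complex-linear is automatic, since it is a limit of elements of that space.
\<close>

lemma Hol_uniform_limit:
  fixes X :: "nat \<Rightarrow> 'e::cbanach \<Rightarrow> 'f::cbanach"
  assumes U: "open U" and X: "\<And>n. X n \<in> Hol U"
    and Cauchy: "\<And>e. 0 < e \<Longrightarrow> \<exists>M. \<forall>m\<ge>M. \<forall>n\<ge>M. \<forall>x\<in>U. norm (X m x - X n x) \<le> e"
  obtains f where "f \<in> Hol U" "\<And>x. (\<lambda>n. X n x) \<longlonglongrightarrow> f x"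
proof -
  have conv: "\<exists>l. (\<lambda>n. X n x) \<longlonglongrightarrow> l" for x
  proof (cases "x \<in> U")
    case True
    have "Cauchy (\<lambda>n. X n x)"
    proof (rule CauchyI)
      fix e :: real assume "0 < e"
      then obtain M where "\<forall>m\<ge>M. \<forall>n\<ge>M. norm (X m x - X n x) \<le> e / 2"
        using Cauchy[of "e / 2"] True by auto
      with \<open>0 < e\<close> show "\<exists>M. \<forall>m\<ge>M. \<forall>n\<ge>M. norm (X m x - X n x) < e"
        by (intro exI[of _ M]) fastforce
    qed
    then show ?thesis by (simp add: Cauchy_convergent_iff convergent_def)
  next
    case False
    then show ?thesis using Hol_off[OF X] by auto
  qed
  define f where "f x = lim (\<lambda>n. X n x)" for x
  have lim: "(\<lambda>n. X n x) \<longlonglongrightarrow> f x" for x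
    using conv[of x] by (auto simp: f_def convergent_def convergent_LIMSEQ_iff[symmetric])
  have "f \<in> Hol U"
  proof (rule HolI)
    fix x assume x: "x \<in> U"
    obtain s where s: "0 < s" "cball x s \<subseteq> U"
      using U x open_contains_cball by blast
    \<comment> \<open>half the radius, so that balls of radius \<open>r\<close> around points of \<open>B\<close> stay in \<open>U\<close>\<close>
    define r where "r = s / 2"
    have r: "0 < r" using s by (simp add: r_def)
    define B where "B = ball x r"
    have cball: "cball y r \<subseteq> U" if "y \<in> B" for y
    proof -
      have "cball y r \<subseteq> cball x s"
      proof
        fix z assume "z \<in> cball y r"
        then show "z \<in> cball x s"
          using that dist_triangle[of x z y] by (simp add: B_def r_def)
      qed
      with s show ?thesis by blast
    qed
    have BU: "y \<in> U" if "y \<in> B" for y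
      using cball[OF that] r by auto
    have "\<forall>n. \<forall>y\<in>U. \<exists>D :: ('e, 'f) cblinfun. (X n has_derivative cblinfun_apply D) (at y)"
      using X by (simp add: Hol_def)
    then obtain D :: "nat \<Rightarrow> 'e \<Rightarrow> ('e, 'f) cblinfun" where
      D: "\<And>n y. y \<in> U \<Longrightarrow> (X n has_derivative cblinfun_apply (D n y)) (at y)"
      by metis
    have D_Cauchy: "\<exists>M. \<forall>m\<ge>M. \<forall>n\<ge>M. \<forall>y\<in>B. norm (D m y - D n y) \<le> e" if e: "0 < e" for e
    proof -
      obtain M where M: "\<And>m n y. M \<le> m \<Longrightarrow> M \<le> n \<Longrightarrow> y \<in> U \<Longrightarrow> norm (X m y - X n y) \<le> e * r"
        using Cauchy[of "e * r"] e r by auto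
      have "norm (D m y - D n y) \<le> e * r / r" if "M \<le> m" "M \<le> n" "y \<in> B" for m n y
      proof (rule Cauchy_estimate_derivative[OF Hol_diff[OF X X] r cball])
        show "((\<lambda>x. X m x - X n x) has_derivative cblinfun_apply (D m y - D n y)) (at y)"
          unfolding minus_apply[abs_def] by (intro has_derivative_diff D BU that)
        show "norm (X m z - X n z) \<le> e * r" if "z \<in> cball y r" for z
          using M[OF \<open>M \<le> m\<close> \<open>M \<le> n\<close>] cball[OF \<open>y \<in> B\<close>] that by blast
      qed (use that in auto)
      with r show ?thesis by auto
    qed
    have "\<exists>L. (\<lambda>n. D n y) \<longlonglongrightarrow> L" if "y \<in> B" for y
    proof -
      have "Cauchy (\<lambda>n. D n y)"
      proof (rule CauchyI)
        fix e :: real assume "0 < e"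
        then obtain M where "\<forall>m\<ge>M. \<forall>n\<ge>M. norm (D m y - D n y) \<le> e / 2"
          using D_Cauchy[of "e / 2"] \<open>y \<in> B\<close> by auto
        with \<open>0 < e\<close> show "\<exists>M. \<forall>m\<ge>M. \<forall>n\<ge>M. norm (D m y - D n y) < e"
          by (intro exI[of _ M]) fastforce
      qed
      then show ?thesis by (simp add: Cauchy_convergent_iff convergent_def)
    qed
    then obtain L where L: "\<And>y. y \<in> B \<Longrightarrow> (\<lambda>n. D n y) \<longlonglongrightarrow> L y"
      by metis
    have "\<exists>g. \<forall>y\<in>B. (\<lambda>n. X n y) \<longlonglongrightarrow> g y \<and> (g has_derivative cblinfun_apply (L y)) (at y within B)"
    proof (rule has_derivative_sequence)
      show "convex B" by (simp add: B_def)
      show "(X n has_derivative cblinfun_apply (D n y)) (at y within B)" if "y \<in> B" for n y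
        by (rule has_derivative_at_withinI[OF D[OF BU[OF that]]])
      show "x \<in> B" using r by (simp add: B_def)
      show "(\<lambda>n. X n x) \<longlonglongrightarrow> f x" by (rule lim)
      fix e :: real assume "0 < e"
      then obtain M where M: "\<And>m n y. M \<le> m \<Longrightarrow> M \<le> n \<Longrightarrow> y \<in> B \<Longrightarrow> norm (D m y - D n y) \<le> e"
        using D_Cauchy by blast
      have "norm (cblinfun_apply (D m y) h - cblinfun_apply (L y) h) \<le> e * norm h"
        if "M \<le> m" "y \<in> B" for m y h
      proof -
        have "norm (D m y - L y) \<le> e"
        proof (rule tendsto_upperbound)
          show "(\<lambda>n. norm (D m y - D n y)) \<longlonglongrightarrow> norm (D m y - L y)"
            by (intro tendsto_intros L that)
          show "\<forall>\<^sub>F n in sequentially. norm (D m y - D n y) \<le> e"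
            using eventually_ge_at_top[of M] by eventually_elim (use M that in auto)
        qed simp
        then have "norm (cblinfun_apply (D m y - L y) h) \<le> e * norm h"
          using norm_cblinfun_apply_le[of "D m y - L y" h] mult_right_mono[of _ e "norm h"]
          by (meson norm_ge_zero order_trans)
        then show ?thesis by (simp add: minus_apply)
      qed
      then show "\<forall>\<^sub>F n in sequentially. \<forall>y\<in>B. \<forall>h.
          norm (cblinfun_apply (D n y) h - cblinfun_apply (L y) h) \<le> e * norm h"
        by (intro eventually_sequentiallyI[of M]) blast
    qed
    then obtain g where g: "\<And>y. y \<in> B \<Longrightarrow> (\<lambda>n. X n y) \<longlonglongrightarrow> g y"
      "\<And>y. y \<in> B \<Longrightarrow> (g has_derivative cblinfun_apply (L y)) (at y within B)"
      by blast
    have xB: "x \<in> B" and oB: "open B" using r by (simp_all add: B_def)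
    have "(g has_derivative cblinfun_apply (L x)) (at x)"
      using g(2)[OF xB] at_within_open[OF xB oB] by simp
    then have "(f has_derivative cblinfun_apply (L x)) (at x)"
      by (rule has_derivative_transform_within_open[OF _ oB xB])
        (rule LIMSEQ_unique[OF g(1) lim])
    then show "\<exists>D :: ('e, 'f) cblinfun. (f has_derivative cblinfun_apply D) (at x)" by blast
  next
    fix x assume "x \<notin> U"
    then have "(\<lambda>n. X n x) = (\<lambda>_. 0)" using Hol_off[OF X] by auto
    then show "f x = 0" using LIMSEQ_unique[OF lim[of x], of 0] by simp
  qed
  with lim show thesis by (rule that[rotated])
qed

section \<open>The supremum norm\<close>

lemma norm_le_sup_norm:
  assumes "bounded (f ` U)" "x \<in> U"
  shows "norm (f x) \<le> sup_norm U f"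
  unfolding sup_norm_def
proof (rule cSup_upper)
  obtain B where "\<forall>y\<in>f ` U. norm y \<le> B"
    using assms(1) by (auto simp: bounded_iff)
  then show "bdd_above (insert 0 ((\<lambda>x. norm (f x)) ` U))"
    by (intro bdd_aboveI[of _ "max 0 B"]) (auto simp: le_max_iff_disj)
qed (use assms(2) in simp)

lemma sup_norm_nonneg:
  assumes "bounded (f ` U)"
  shows "0 \<le> sup_norm U f"
proof (cases "U = {}")
  case False
  then obtain x where "x \<in> U" by blast
  from norm_ge_zero norm_le_sup_norm[OF assms this] show ?thesis by (rule order_trans)
qed (simp add: sup_norm_def)

lemma sup_norm_le:
  assumes "0 \<le> C" "\<And>x. x \<in> U \<Longrightarrow> norm (f x) \<le> C"
  shows "sup_norm U f \<le> C"
  unfolding sup_norm_def by (rule cSup_least) (use assms in auto)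


section \<open>The ideal of Cohen strongly summing mappings\<close>

context
  fixes p :: ennreal
  assumes p: "1 \<le> p"
begin

lemmas cohen_attained = cohen_bound_cohen_norm[OF p]

lemma cohen_norm_nonneg: "f \<in> cohen_summing p U \<Longrightarrow> 0 \<le> cohen_norm p U f"
  by (rule cohen_bound_nonneg[OF cohen_attained])

lemma norm_le_cohen_norm: "f \<in> cohen_summing p U \<Longrightarrow> x \<in> U \<Longrightarrow> norm (f x) \<le> cohen_norm p U f"
  by (rule norm_le_cohen_bound[OF p cohen_attained])

lemma cohen_summing_subset_Hinf: "cohen_summing p U \<subseteq> Hinf U"
  using norm_le_cohen_norm
  by (fastforce simp: Hinf_def cohen_summing_def intro!: boundedI)

lemma cohen_summing_zero: "(\<lambda>_. 0) \<in> cohen_summing p U"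
  using Hol_zero cohen_bound_zero by (auto simp: cohen_summing_def)

lemma cohen_summing_add:
  "f \<in> cohen_summing p U \<Longrightarrow> g \<in> cohen_summing p U \<Longrightarrow> (\<lambda>x. f x + g x) \<in> cohen_summing p U"
  using Hol_add cohen_bound_add by (fastforce simp: cohen_summing_def)

lemma cohen_summing_scaleC:
  "f \<in> cohen_summing p U \<Longrightarrow> (\<lambda>x. c *\<^sub>C f x) \<in> cohen_summing p U"
  using Hol_scaleC cohen_bound_scaleC by (fastforce simp: cohen_summing_def)

lemma cohen_summing_diff:
  "f \<in> cohen_summing p U \<Longrightarrow> g \<in> cohen_summing p U \<Longrightarrow> (\<lambda>x. f x - g x) \<in> cohen_summing p U"
  using cohen_summing_add[OF _ cohen_summing_scaleC[of g U "- 1"]] by (simp add: scaleC_minus_one)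

lemma cohen_norm_add_le:
  "f \<in> cohen_summing p U \<Longrightarrow> g \<in> cohen_summing p U \<Longrightarrow>
    cohen_norm p U (\<lambda>x. f x + g x) \<le> cohen_norm p U f + cohen_norm p U g"
  by (intro cohen_norm_le p cohen_bound_add cohen_attained)

text \<open>
  The nontrivial inequality is the trivial one applied to \<open>1 / c\<close> and \<open>c f\<close>.
\<close>

lemma cohen_norm_scaleC:
  assumes f: "f \<in> cohen_summing p U"
  shows "cohen_norm p U (\<lambda>x. c *\<^sub>C f x) = cmod c * cohen_norm p U f"
proof (rule antisym)
  have le: "cohen_norm p U (\<lambda>x. c *\<^sub>C f x) \<le> cmod c * cohen_norm p U f"
    if "f \<in> cohen_summing p U" for c f
    by (intro cohen_norm_le p cohen_bound_scaleC cohen_attained that)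
  show "cohen_norm p U (\<lambda>x. c *\<^sub>C f x) \<le> cmod c * cohen_norm p U f"
    by (rule le[OF f])
  show "cmod c * cohen_norm p U f \<le> cohen_norm p U (\<lambda>x. c *\<^sub>C f x)"
  proof (cases "c = 0")
    case True
    then show ?thesis using cohen_norm_nonneg[OF cohen_summing_scaleC[OF f]] by simp
  next
    case False
    then have "cohen_norm p U f \<le> cmod (1 / c) * cohen_norm p U (\<lambda>x. c *\<^sub>C f x)"
      using le[OF cohen_summing_scaleC[OF f, of c], of "1 / c"]
      by (simp add: scaleC_scaleC scaleC_one)
    with False show ?thesis by (simp add: norm_divide field_simps)
  qed
qed

lemma cohen_norm_eq_0_iff:
  assumes f: "f \<in> cohen_summing p U"
  shows "cohen_norm p U f = 0 \<longleftrightarrow> f = (\<lambda>_. 0)"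
proof
  assume 0: "cohen_norm p U f = 0"
  show "f = (\<lambda>_. 0)"
  proof
    fix x
    show "f x = 0"
    proof (cases "x \<in> U")
      case True
      then show ?thesis using norm_le_cohen_norm[OF f, of x] 0 by simp
    next
      case False
      then show ?thesis using f Hol_off[of f U x] by (simp add: cohen_summing_def)
    qed
  qed
next
  assume "f = (\<lambda>_. 0)"
  then have "cohen_norm p U f \<le> 0"
    by (simp add: cohen_norm_le[OF p cohen_bound_zero])
  with cohen_norm_nonneg[OF f] show "cohen_norm p U f = 0" by simp
qed

lemma cohen_summing_subspace: "function_subspace (cohen_summing p U)"
  by (simp add: function_subspace_def cohen_summing_zero cohen_summing_add cohen_summing_scaleC)

lemma cohen_summing_normed: "normed_function_space (cohen_summing p U) (cohen_norm p U)"
  by (simp add: normed_function_space_def cohen_summing_subspace cohen_norm_nonneg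
      cohen_norm_eq_0_iff cohen_norm_scaleC cohen_norm_add_le)

text \<open>
  The norm dominates the supremum norm, so a Cauchy sequence has a uniform holomorphic limit \<open>f\<close>.
  Letting \<open>n\<close> tend to infinity in the constants for \<open>X m - X n\<close> gives small constants for \<open>X m - f\<close>;
  this shows both that \<open>f\<close> is Cohen strongly summing and that the convergence is in the norm.
\<close>

lemma cohen_summing_complete:
  fixes X :: "nat \<Rightarrow> 'e::cbanach \<Rightarrow> 'f::cbanach"
  assumes U: "open U" and X: "\<And>n. X n \<in> cohen_summing p U"
    and Cauchy: "\<forall>e>0. \<exists>M. \<forall>m\<ge>M. \<forall>n\<ge>M. cohen_norm p U (\<lambda>x. X m x - X n x) < e"
  shows "\<exists>f\<in>cohen_summing p U. (\<lambda>n. cohen_norm p U (\<lambda>x. X n x - f x)) \<longlonglongrightarrow> 0"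
proof -
  note X_diff = cohen_summing_diff[OF X X]
  have X_Hol: "X n \<in> Hol U" for n
    using X by (simp add: cohen_summing_def)
  have "\<exists>M. \<forall>m\<ge>M. \<forall>n\<ge>M. \<forall>x\<in>U. norm (X m x - X n x) \<le> e" if "0 < e" for e
    using Cauchy[rule_format, OF that] norm_le_cohen_norm[OF X_diff]
    by (meson less_imp_le order_trans)
  from Hol_uniform_limit[OF U X_Hol this]
  obtain f where f: "f \<in> Hol U" "\<And>x. (\<lambda>n. X n x) \<longlonglongrightarrow> f x"
    by metis
  have near: "\<exists>M. \<forall>m\<ge>M. cohen_bound p U (\<lambda>x. X m x - f x) e" if e: "0 < e" for e
  proof -
    obtain M where M: "\<And>m n. M \<le> m \<Longrightarrow> M \<le> n \<Longrightarrow> cohen_norm p U (\<lambda>x. X m x - X n x) < e"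
      using Cauchy e by blast
    have "cohen_bound p U (\<lambda>x. X m x - f x) e" if m: "M \<le> m" for m
    proof (rule cohen_bound_limit)
      show "(\<lambda>n. X m x - X n x) \<longlonglongrightarrow> X m x - f x" for x
        by (intro tendsto_intros f)
      show "\<forall>\<^sub>F n in sequentially. cohen_bound p U (\<lambda>x. X m x - X n x) e"
      proof (rule eventually_sequentiallyI)
        fix n assume "M \<le> n"
        with M m show "cohen_bound p U (\<lambda>x. X m x - X n x) e"
          by (intro cohen_bound_mono[OF p cohen_attained[OF X_diff]] less_imp_le)
      qed
    qed
    then show ?thesis by blast
  qed
  have diff: "(\<lambda>x. X m x - f x) \<in> cohen_summing p U" if "cohen_bound p U (\<lambda>x. X m x - f x) e" for m e
    using that Hol_diff[OF X_Hol f(1)] by (auto simp: cohen_summing_def)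
  obtain M where "cohen_bound p U (\<lambda>x. X M x - f x) 1"
    using near[of 1] by auto
  from cohen_summing_diff[OF X diff[OF this], of M]
  have "f \<in> cohen_summing p U" by simp
  moreover have "(\<lambda>n. cohen_norm p U (\<lambda>x. X n x - f x)) \<longlonglongrightarrow> 0"
  proof (rule LIMSEQ_I)
    fix e :: real assume "0 < e"
    then obtain M where M: "\<And>m. M \<le> m \<Longrightarrow> cohen_bound p U (\<lambda>x. X m x - f x) (e / 2)"
      using near[of "e / 2"] by auto
    have "norm (cohen_norm p U (\<lambda>x. X n x - f x) - 0) < e" if "M \<le> n" for n
      using cohen_norm_le[OF p M[OF that]] cohen_norm_nonneg[OF diff[OF M[OF that]]] \<open>0 < e\<close>
      by simp
    then show "\<exists>M. \<forall>n\<ge>M. norm (cohen_norm p U (\<lambda>x. X n x - f x) - 0) < e" by blast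
  qed
  ultimately show ?thesis by blast
qed

text \<open>
  The norm is at most the product because that product is a constant, and at least the product
  because the norm dominates the supremum norm.
\<close>

lemma cohen_summing_scaleC_const:
  assumes g: "g \<in> Hinf U"
  shows "(\<lambda>x. g x *\<^sub>C y) \<in> cohen_summing p U"
    and "cohen_norm p U (\<lambda>x. g x *\<^sub>C y) = sup_norm U g * norm y"
proof -
  have gH: "g \<in> Hol U" and gb: "bounded (g ` U)"
    using g by (auto simp: Hinf_def)
  have bound: "cohen_bound p U (\<lambda>x. g x *\<^sub>C y) (sup_norm U g * norm y)"
    by (intro cohen_bound_scaleC_const p sup_norm_nonneg norm_le_sup_norm gb)
  then show mem: "(\<lambda>x. g x *\<^sub>C y) \<in> cohen_summing p U"
    using Hol_scaleC_const[OF gH] by (auto simp: cohen_summing_def)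
  show "cohen_norm p U (\<lambda>x. g x *\<^sub>C y) = sup_norm U g * norm y"
  proof (rule antisym[OF cohen_norm_le[OF p bound]])
    show "sup_norm U g * norm y \<le> cohen_norm p U (\<lambda>x. g x *\<^sub>C y)"
    proof (cases "y = 0")
      case True
      then show ?thesis using cohen_norm_nonneg[OF mem] by simp
    next
      case False
      have "sup_norm U g \<le> cohen_norm p U (\<lambda>x. g x *\<^sub>C y) / norm y"
        using cohen_norm_nonneg[OF mem] norm_le_cohen_norm[OF mem] False
        by (intro sup_norm_le) (simp_all add: pos_le_divide_eq norm_scaleC)
      with False show ?thesis by (simp add: pos_le_divide_eq)
    qed
  qed
qed

lemma cohen_summing_compose:
  assumes V: "open V" and h: "h \<in> Hol_into V U" and f: "f \<in> cohen_summing p U"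
  shows "zero_ext V (cblinfun_apply S \<circ> f \<circ> h) \<in> cohen_summing p V"
    and "cohen_norm p V (zero_ext V (cblinfun_apply S \<circ> f \<circ> h)) \<le> norm S * cohen_norm p U f"
proof -
  have hV: "h ` V \<subseteq> U" using h by (simp add: Hol_into_def)
  have fH: "f \<in> Hol U" using f by (simp add: cohen_summing_def)
  have bound: "cohen_bound p V (zero_ext V (cblinfun_apply S \<circ> f \<circ> h)) (norm S * cohen_norm p U f)"
    by (rule cohen_bound_compose[OF p cohen_attained[OF f] hV])
  have "zero_ext V (cblinfun_apply S \<circ> f \<circ> h) = (\<lambda>x. cblinfun_apply S (zero_ext V (f \<circ> h) x))"
    by (auto simp: zero_ext_def cblinfun_apply_zero)
  with Hol_postcompose[OF Hol_precompose[OF fH h V]] bound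
  show "zero_ext V (cblinfun_apply S \<circ> f \<circ> h) \<in> cohen_summing p V"
    by (auto simp: cohen_summing_def)
  show "cohen_norm p V (zero_ext V (cblinfun_apply S \<circ> f \<circ> h)) \<le> norm S * cohen_norm p U f"
    by (rule cohen_norm_le[OF p bound])
qed

text \<open>
  One inequality between the norms is the passage from the bidual back to \<open>F\<close>; the other is
  composition with \<open>\<kappa>\<close>, an operator of norm at most \<open>1\<close>.
\<close>

lemma cohen_summing_regular:
  fixes f :: "'e::cbanach \<Rightarrow> 'f::cbanach"
  assumes f: "f \<in> Hol U"
    and \<kappa>f: "cblinfun_apply canonical_embedding \<circ> f \<in> cohen_summing p U"
  shows "f \<in> cohen_summing p U"
    and "cohen_norm p U f = cohen_norm p U (cblinfun_apply canonical_embedding \<circ> f)"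
proof -
  have bound: "cohen_bound p U f (cohen_norm p U (cblinfun_apply canonical_embedding \<circ> f))"
    by (rule cohen_bound_of_bidual[OF p cohen_attained[OF \<kappa>f]])
  with f show mem: "f \<in> cohen_summing p U" by (auto simp: cohen_summing_def)
  have ext: "zero_ext U (cblinfun_apply canonical_embedding \<circ> f \<circ> id)
      = cblinfun_apply canonical_embedding \<circ> f"
    using Hol_off[OF f] by (auto simp: zero_ext_def cblinfun_apply_zero)
  have "cohen_bound p U (cblinfun_apply canonical_embedding \<circ> f)
      (norm (canonical_embedding :: ('f, _) cblinfun) * cohen_norm p U f)"
    using cohen_bound_compose[OF p cohen_attained[OF mem], of id U canonical_embedding]
    unfolding ext by simp
  then have "cohen_norm p U (cblinfun_apply canonical_embedding \<circ> f)
      \<le> norm (canonical_embedding :: ('f, _) cblinfun) * cohen_norm p U f"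
    by (rule cohen_norm_le[OF p])
  also have "\<dots> \<le> 1 * cohen_norm p U f"
    by (intro mult_right_mono norm_canonical_embedding cohen_norm_nonneg[OF mem])
  finally show "cohen_norm p U f = cohen_norm p U (cblinfun_apply canonical_embedding \<circ> f)"
    using cohen_norm_le[OF p bound] by simp
qed

end

lemma cohen_summing_1:
  fixes f :: "'e::cbanach \<Rightarrow> 'f::cbanach"
  shows "(cohen_summing 1 U :: ('e \<Rightarrow> 'f) set) = Hinf U"
    and "f \<in> Hinf U \<Longrightarrow> cohen_norm 1 U f = sup_norm U f"
proof -
  have bound: "cohen_bound 1 U f (sup_norm U f)" if "f \<in> Hinf U" for f :: "'e \<Rightarrow> 'f"
    using that by (intro cohen_bound_1 sup_norm_nonneg norm_le_sup_norm) (auto simp: Hinf_def)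
  then show eq: "(cohen_summing 1 U :: ('e \<Rightarrow> 'f) set) = Hinf U"
    using cohen_summing_subset_Hinf[of 1 U] by (auto simp: cohen_summing_def Hinf_def)
  show "cohen_norm 1 U f = sup_norm U f" if f: "f \<in> Hinf U"
  proof (rule antisym)
    show "cohen_norm 1 U f \<le> sup_norm U f"
      by (rule cohen_norm_le[OF _ bound[OF f]]) simp
    have "f \<in> cohen_summing 1 U" using f eq by simp
    then show "sup_norm U f \<le> cohen_norm 1 U f"
      by (intro sup_norm_le cohen_norm_nonneg norm_le_cohen_norm) auto
  qed
qed

theorem proposition2p5:
  fixes p :: ennreal
  assumes "1 \<le> p"
  shows "regular_banach_holo_ideal
           (cohen_summing p :: 'e::cbanach set \<Rightarrow> ('e \<Rightarrow> 'f::cbanach) set) (cohen_norm p)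
           (cohen_summing p :: 'h::cbanach set \<Rightarrow> ('h \<Rightarrow> 'g::cbanach) set) (cohen_norm p)
           (cohen_summing p :: 'e set \<Rightarrow> ('e \<Rightarrow> 'f cdual cdual) set) (cohen_norm p) \<and>
         (\<forall>U :: 'e set. open U \<longrightarrow>
            (cohen_summing 1 U :: ('e \<Rightarrow> 'f) set) = Hinf U \<and>
            (\<forall>f \<in> (cohen_summing 1 U :: ('e \<Rightarrow> 'f) set). cohen_norm 1 U f = sup_norm U f))"
proof (intro conjI)
  note p = \<open>1 \<le> p\<close>
  show "regular_banach_holo_ideal
           (cohen_summing p :: 'e set \<Rightarrow> ('e \<Rightarrow> 'f) set) (cohen_norm p)
           (cohen_summing p :: 'h set \<Rightarrow> ('h \<Rightarrow> 'g) set) (cohen_norm p)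
           (cohen_summing p :: 'e set \<Rightarrow> ('e \<Rightarrow> 'f cdual cdual) set) (cohen_norm p)"
    unfolding regular_banach_holo_ideal_def
  proof (intro conjI)
    show "holo_ideal_component (cohen_summing p :: 'e set \<Rightarrow> ('e \<Rightarrow> 'f) set)"
      unfolding holo_ideal_component_def
      using cohen_summing_subset_Hinf[OF p] cohen_summing_subspace[OF p]
        cohen_summing_scaleC_const(1)[OF p]
      by blast
    show "holo_ideal_composition (cohen_summing p :: 'e set \<Rightarrow> ('e \<Rightarrow> 'f) set)
        (cohen_summing p :: 'h set \<Rightarrow> ('h \<Rightarrow> 'g) set)"
      unfolding holo_ideal_composition_def using cohen_summing_compose(1)[OF p] by blast
    show "banach_ideal_component (cohen_summing p :: 'e set \<Rightarrow> ('e \<Rightarrow> 'f) set) (cohen_norm p)"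
      unfolding banach_ideal_component_def banach_function_space_def
      by (auto simp: cohen_summing_normed[OF p] cohen_summing_scaleC_const(2)[OF p]
          intro!: cohen_summing_complete[OF p] sup_norm_le
            cohen_norm_nonneg[OF p] norm_le_cohen_norm[OF p])
    show "normed_ideal_composition (cohen_summing p :: 'e set \<Rightarrow> ('e \<Rightarrow> 'f) set) (cohen_norm p)
        (cohen_norm p :: 'h set \<Rightarrow> ('h \<Rightarrow> 'g) \<Rightarrow> real)"
      unfolding normed_ideal_composition_def using cohen_summing_compose(2)[OF p] by blast
    show "regular_ideal_component (cohen_summing p :: 'e set \<Rightarrow> ('e \<Rightarrow> 'f) set) (cohen_norm p)
        (cohen_summing p :: 'e set \<Rightarrow> ('e \<Rightarrow> 'f cdual cdual) set) (cohen_norm p)"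
      unfolding regular_ideal_component_def
      using cohen_summing_regular[OF p] by (auto simp: Hinf_def)
  qed
  show "\<forall>U :: 'e set. open U \<longrightarrow>
            (cohen_summing 1 U :: ('e \<Rightarrow> 'f) set) = Hinf U \<and>
            (\<forall>f \<in> (cohen_summing 1 U :: ('e \<Rightarrow> 'f) set). cohen_norm 1 U f = sup_norm U f)"
    by (simp add: cohen_summing_1)
qed

end
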